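(* Let $\Omega$ be a countably infinite set, and let $f, g, h \in \mathrm{Inj}(\Omega)$ be any three maps that have infinite support. Further, suppose that $f$ and $g$ both have at least one infinite cycle. Then there exist permutations $a, b \in \mathrm{Sym}(\Omega)$ such that $h = afa^{-1}bgb^{-1}$ if and only if $|\Omega \setminus (\Omega)f| + |\Omega \setminus (\Omega)g| = |\Omega \setminus (\Omega)h|$.
   Context: $\mathrm{Inj}(\Omega)$ is the monoid of all injective maps $\Omega \to \Omega$, and $\mathrm{Sym}(\Omega)$ is the group of all permutations of $\Omega$. Maps are written on the right of their arguments, so $(\alpha)fg = ((\alpha)f)g$, and $(\Omega)f$ denotes the image of $f$. $|\cdot|$ denotes cardinality, and sums are sums of cardinals. The support of $f \in \mathrm{Inj}(\Omega)$ is the set $\{\alpha \in \Omega : (\alpha)f \neq \alpha\}$. For $f \in \mathrm{Inj}(\Omega)$, a nonempty set $\Sigma \subseteq \Omega$ is a cycle under $f$ if (i) for all $\alpha \in \Omega$, $(\alpha)f \in \Sigma$ if and only if $\alpha \in \Sigma$; and (ii) $\Sigma$ has no proper nonempty subset satisfying (i). An infinite cycle is a cycle that is an infinite set. (Equivalently, $f$ has an infinite cycle if there exists $\alpha \in \Omega$ with $\alpha \neq (\alpha)f^i$ for all positive integers $i$.) *)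

theory Defs
  imports "HOL-Library.FuncSet" "HOL-Library.Countable_Set" "HOL-Combinatorics.Permutations"
begin

text \<open>
  The base set is an arbitrary carrier set. The values of a map in \<open>Inj \<Omega>\<close> outside
  \<open>\<Omega>\<close> are irrelevant, so maps are compared on \<open>\<Omega>\<close> only. A permutation of \<open>\<Omega>\<close> is a map
  that \<open>permutes\<close> \<open>\<Omega>\<close>; it is the identity outside \<open>\<Omega>\<close>, so its inverse is
  given by \<open>inv\<close>.
\<close>

definition Inj :: "'a set \<Rightarrow> ('a \<Rightarrow> 'a) set" where
  "Inj \<Omega> = {f \<in> \<Omega> \<rightarrow> \<Omega>. inj_on f \<Omega>}"

definition Sym :: "'a set \<Rightarrow> ('a \<Rightarrow> 'a) set" where
  "Sym \<Omega> = {a. a permutes \<Omega>}"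

definition support :: "'a set \<Rightarrow> ('a \<Rightarrow> 'a) \<Rightarrow> 'a set" where
  "support \<Omega> f = {\<alpha> \<in> \<Omega>. f \<alpha> \<noteq> \<alpha>}"

definition invariant_under :: "'a set \<Rightarrow> ('a \<Rightarrow> 'a) \<Rightarrow> 'a set \<Rightarrow> bool" where
  "invariant_under \<Omega> f \<Sigma> \<longleftrightarrow> (\<forall>\<alpha>\<in>\<Omega>. f \<alpha> \<in> \<Sigma> \<longleftrightarrow> \<alpha> \<in> \<Sigma>)"

definition cycle_under :: "'a set \<Rightarrow> ('a \<Rightarrow> 'a) \<Rightarrow> 'a set \<Rightarrow> bool" where
  "cycle_under \<Omega> f \<Sigma> \<longleftrightarrow>
     \<Sigma> \<noteq> {} \<and> \<Sigma> \<subseteq> \<Omega> \<and> invariant_under \<Omega> f \<Sigma> \<and>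
     \<not> (\<exists>\<Sigma>'. \<Sigma>' \<noteq> {} \<and> \<Sigma>' \<subset> \<Sigma> \<and> invariant_under \<Omega> f \<Sigma>')"

definition has_infinite_cycle :: "'a set \<Rightarrow> ('a \<Rightarrow> 'a) \<Rightarrow> bool" where
  "has_infinite_cycle \<Omega> f \<longleftrightarrow> (\<exists>\<Sigma>. cycle_under \<Omega> f \<Sigma> \<and> infinite \<Sigma>)"

text \<open>
  Maps written on the right compose from left to right, so \<open>a f a\<^sup>-\<^sup>1 b g b\<^sup>-\<^sup>1\<close> applies
  \<open>a\<close> first and \<open>b\<^sup>-\<^sup>1\<close> last.
\<close>

definition conj_product :: "('a \<Rightarrow> 'a) \<Rightarrow> ('a \<Rightarrow> 'a) \<Rightarrow> ('a \<Rightarrow> 'a) \<Rightarrow> ('a \<Rightarrow> 'a) \<Rightarrow> 'a \<Rightarrow> 'a" where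
  "conj_product a f b g = inv b \<circ> g \<circ> b \<circ> inv a \<circ> f \<circ> a"

unbundle cardinal_syntax

end

theory Submission
  imports Defs "HOL-Library.Ramsey"
begin

text \<open>
  Necessity is a count: if \<open>h = g' \<circ> f'\<close> with \<open>f'\<close> and \<open>g'\<close> conjugate to \<open>f\<close> and \<open>g\<close>, the points missed
  by \<open>h\<close> are the points missed by \<open>g'\<close> and the \<open>g'\<close>-images of the points missed by \<open>f'\<close>
  (\<open>conj_product_deficiency\<close>).

  For sufficiency, split the points missed by \<open>h\<close> into a set \<open>P\<close> as large as \<open>\<Omega> - f ` \<Omega>\<close> and a set \<open>Q\<close> as
  large as \<open>\<Omega> - g ` \<Omega>\<close>, and let \<open>W = \<Omega> - Q\<close>. Every bijection \<open>\<sigma> : W \<rightarrow> \<Omega>\<close> yields a factorization \<open>h = g' \<circ> f'\<close>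
  with \<open>f' = \<sigma> \<circ> h\<close> and \<open>g' = \<sigma>\<^sup>-\<^sup>1\<close>, in which \<open>f'\<close> misses exactly \<open>\<sigma> ` P\<close> and \<open>g'\<close> misses exactly \<open>Q\<close>. So the
  equation is free, and the task is to choose \<open>\<sigma>\<close> such that both factors have the right cycles.

  Fix an infinite cycle \<open>C\<close> of \<open>f\<close> and \<open>D\<close> of \<open>g\<close>. What \<open>f\<close> does outside \<open>C\<close> and \<open>g\<close> outside \<open>D\<close> is copied
  beforehand onto sets \<open>A\<close> and \<open>B\<close>, chosen so sparsely with respect to \<open>h\<close> (\<open>exists_sparse_set\<close>) that
  the two prescriptions do not interfere and leave infinitely many points untouched. It remains to
  make \<open>f'\<close> one infinite orbit outside \<open>A\<close> and \<open>g'\<close> one infinite orbit outside \<open>B\<close>. Starting from the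
  prescribed values, \<open>\<sigma>\<close> is extended by one pair at a time, keeping all unfinished paths of both factors
  finite (\<open>admissible_insert\<close>). Every point can be brought into the domain and into the range, and any
  two paths of \<open>f'\<close>, or of \<open>g'\<close>, can be joined through an untouched point \<open>u\<close> with \<open>h u \<noteq> u\<close>
  (\<open>join_induced_ends\<close>, \<open>join_ends\<close>); such points exist because \<open>h\<close> has infinite support. In the limit
  (\<open>complete_linking\<close>) both remaining parts are connected and without cycles. Such an orbit has a
  first point exactly if a point of \<open>P\<close>, respectively \<open>Q\<close>, was left for it, that is, if \<open>C\<close>, respectively \<open>D\<close>,
  has a first point. Hence it is isomorphic to \<open>C\<close> or \<open>D\<close> (\<open>infinite_orbits_isomorphic\<close>), and \<open>f'\<close> and \<open>g'\<close> are conjugate to \<open>f\<close> and \<open>g\<close>.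
\<close>

section \<open>Necessity: counting the points outside the image\<close>

lemma bij_betw_case_sum:
  assumes u: "inj_on u X" and v: "inj_on v Y" and disj: "u ` X \<inter> v ` Y = {}"
  shows "bij_betw (case_sum u v) (X <+> Y) (u ` X \<union> v ` Y)"
proof (rule bij_betw_imageI)
  show "case_sum u v ` (X <+> Y) = u ` X \<union> v ` Y"
    unfolding Plus_def image_Un image_image by simp
  show "inj_on (case_sum u v) (X <+> Y)"
  proof (rule inj_onI)
    fix s t assume st: "s \<in> X <+> Y" "t \<in> X <+> Y" "case_sum u v s = case_sum u v t"
    have "u x \<noteq> v y" if "x \<in> X" "y \<in> Y" for x y using disj that by blast
    then show "s = t" using st inj_onD[OF u] inj_onD[OF v] by (elim PlusE) (simp_all, metis+)
  qed
qed

text \<open>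
  A point is missed by \<open>g' \<circ> f'\<close> if it is missed by \<open>g'\<close>, or is the \<open>g'\<close>-image of a point missed by
  \<open>f'\<close>. Below, \<open>v\<close> carries the points missed by \<open>g\<close>, and \<open>u\<close> those missed by \<open>f\<close>, to their places
  for the conjugates.
\<close>
lemma conj_product_deficiency:
  assumes f: "f \<in> Inj \<Omega>" and g: "g \<in> Inj \<Omega>" and a: "a permutes \<Omega>" and b: "b permutes \<Omega>"
    and h: "\<And>z. z \<in> \<Omega> \<Longrightarrow> h z = conj_product a f b g z"
  shows "|\<Omega> - f ` \<Omega>| +c |\<Omega> - g ` \<Omega>| =o |\<Omega> - h ` \<Omega>|"
proof -
  define u v where "u x = inv b (g (b (inv a x)))" and "v x = inv b x" for x
  have inj: "inj_on f \<Omega>" "inj_on g \<Omega>" and f\<Omega>: "f ` \<Omega> \<subseteq> \<Omega>" and g\<Omega>: "g ` \<Omega> \<subseteq> \<Omega>"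
    using f g by (auto simp: Inj_def)
  have im: "a ` \<Omega> = \<Omega>" "b ` \<Omega> = \<Omega>" "inv a ` \<Omega> = \<Omega>" "inv b ` \<Omega> = \<Omega>"
    using a b permutes_inv permutes_image by metis+
  have inj': "inj a" "inj b" "inj (inv a)" "inj (inv b)"
    using a b permutes_inv permutes_inj by metis+
  have u_inj: "inj_on u \<Omega>"
  proof (rule inj_onI)
    fix x y assume xy: "x \<in> \<Omega>" "y \<in> \<Omega>" "u x = u y"
    then have "g (b (inv a x)) = g (b (inv a y))" using inj'(4) by (simp add: u_def inj_eq)
    moreover have "b (inv a x) \<in> \<Omega>" "b (inv a y) \<in> \<Omega>" using xy im by blast+
    ultimately show "x = y" using inj(2) inj' by (metis inj_eq inj_onD)
  qed
  have u_im: "u ` \<Omega> = v ` g ` \<Omega>"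
  proof -
    have "u ` \<Omega> = v ` g ` b ` inv a ` \<Omega>" by (auto simp: u_def v_def image_image)
    then show ?thesis using im by simp
  qed
  have h_im: "h ` \<Omega> = u ` f ` \<Omega>"
  proof -
    have "h ` \<Omega> = u ` f ` a ` \<Omega>"
      using h by (auto simp: u_def conj_product_def image_image)
    then show ?thesis using im by simp
  qed
  have v_im: "v ` \<Omega> = \<Omega>" using im by (simp add: v_def[abs_def])
  have v_inj: "inj v" using inj' by (simp add: v_def[abs_def])
  have split: "\<Omega> - h ` \<Omega> = u ` (\<Omega> - f ` \<Omega>) \<union> v ` (\<Omega> - g ` \<Omega>)"
  proof -
    have u_diff: "u ` (\<Omega> - f ` \<Omega>) = u ` \<Omega> - h ` \<Omega>"
      using inj_on_image_set_diff[OF u_inj, of \<Omega> "f ` \<Omega>"] f\<Omega> by (simp add: h_im)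
    have v_diff: "v ` (\<Omega> - g ` \<Omega>) = \<Omega> - u ` \<Omega>"
      using image_set_diff[OF v_inj] v_im u_im by simp
    have sub: "h ` \<Omega> \<subseteq> u ` \<Omega>" unfolding h_im by (intro image_mono f\<Omega>)
    have sub': "u ` \<Omega> \<subseteq> \<Omega>" using image_mono[OF g\<Omega>, of v] by (simp add: u_im v_im)
    have "X - Z = (Y - Z) \<union> (X - Y)" if "Z \<subseteq> Y" "Y \<subseteq> X" for X Y Z :: "'a set"
      using that by blast
    from this[OF sub sub'] show ?thesis by (simp only: u_diff v_diff)
  qed
  have disj: "u x \<noteq> v y" if "x \<in> \<Omega>" "y \<in> \<Omega> - g ` \<Omega>" for x y
  proof
    assume "u x = v y"
    moreover have "u x \<in> v ` g ` \<Omega>" using that(1) unfolding u_im[symmetric] by (rule imageI)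
    ultimately obtain y' where "y' \<in> g ` \<Omega>" "v y = v y'" by (metis imageE)
    then show False using that(2) injD[OF v_inj, of y y'] by simp
  qed
  have "bij_betw (case_sum u v) ((\<Omega> - f ` \<Omega>) <+> (\<Omega> - g ` \<Omega>)) (\<Omega> - h ` \<Omega>)"
    unfolding split
  proof (rule bij_betw_case_sum)
    show "inj_on u (\<Omega> - f ` \<Omega>)" by (rule inj_on_subset[OF u_inj Diff_subset])
    show "inj_on v (\<Omega> - g ` \<Omega>)" by (rule inj_on_subset[OF v_inj subset_UNIV])
    show "u ` (\<Omega> - f ` \<Omega>) \<inter> v ` (\<Omega> - g ` \<Omega>) = {}"
    proof (rule equals0I)
      fix z assume z: "z \<in> u ` (\<Omega> - f ` \<Omega>) \<inter> v ` (\<Omega> - g ` \<Omega>)"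
      obtain x where x: "x \<in> \<Omega>" "z = u x" using IntD1[OF z] by (elim imageE DiffE)
      obtain y where y: "y \<in> \<Omega> - g ` \<Omega>" "z = v y" using IntD2[OF z] by (elim imageE)
      show False using disj[OF x(1) y(1)] x(2) y(2) by simp
    qed
  qed
  then show ?thesis unfolding csum_def Field_card_of by (rule card_of_ordIsoI)
qed

section \<open>Relations all of whose paths are finite\<close>

text \<open>
  Finite-path conditions replace acyclicity in the approximations: forbidding cycles alone would
  still allow an infinite path, which has no end at which another path can be attached. With \<open>R\<close>
  and \<open>R\<inverse>\<close> both terminating, every point of \<open>X\<close> lies on a path with a start and an end.
\<close>
definition terminates_on :: "'a set \<Rightarrow> 'a rel \<Rightarrow> bool" where
  "terminates_on X R \<longleftrightarrow> (\<forall>x\<in>X. \<exists>e. (x, e) \<in> R\<^sup>* \<and> e \<notin> Domain R)"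

lemma terminates_onE:
  assumes "terminates_on X R" "x \<in> X"
  obtains e where "(x, e) \<in> R\<^sup>*" "e \<notin> Domain R"
  using assms unfolding terminates_on_def by metis

lemma rtrancl_not_Range:
  assumes "(x, y) \<in> R\<^sup>*" "y \<notin> Range R" shows "x = y"
  using assms by (metis Range.intros rtranclE)

lemma rtrancl_not_Domain:
  assumes "(x, y) \<in> R\<^sup>*" "x \<notin> Domain R" shows "x = y"
  using assms by (metis Domain.intros converse_rtranclE)

text \<open>
  An edge that closes no cycle creates no infinite path: a path that used to end in \<open>e\<close> now runs on
  to the end of the path of \<open>s\<close>, and that end is not \<open>e\<close> itself.
\<close>
lemma terminates_on_insert:
  assumes R: "terminates_on X R" and s: "s \<in> X" and se: "(s, e) \<notin> R\<^sup>*"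
  shows "terminates_on X (insert (e, s) R)"
  unfolding terminates_on_def
proof
  fix x assume "x \<in> X"
  let ?R = "insert (e, s) R"
  have mono: "R\<^sup>* \<subseteq> ?R\<^sup>*" by (rule rtrancl_mono) blast
  obtain e1 where e1: "(x, e1) \<in> R\<^sup>*" "e1 \<notin> Domain R"
    using R \<open>x \<in> X\<close> by (auto simp: terminates_on_def)
  obtain e2 where e2: "(s, e2) \<in> R\<^sup>*" "e2 \<notin> Domain R"
    using R s by (auto simp: terminates_on_def)
  have "e2 \<noteq> e" using se e2 by auto
  show "\<exists>e'. (x, e') \<in> ?R\<^sup>* \<and> e' \<notin> Domain ?R"
  proof (cases "e1 = e")
    case True
    have "(x, e) \<in> ?R\<^sup>*" "(s, e2) \<in> ?R\<^sup>*" using True e1 e2 mono by auto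
    moreover have "(e, s) \<in> ?R" by simp
    ultimately have "(x, e2) \<in> ?R\<^sup>*" by (meson rtrancl.rtrancl_into_rtrancl rtrancl_trans)
    then show ?thesis using e2 \<open>e2 \<noteq> e\<close> by auto
  next
    case False
    then show ?thesis using e1 mono by auto
  qed
qed

lemma terminates_on_converse_insert:
  assumes "terminates_on X (R\<inverse>)" "e \<in> X" "(s, e) \<notin> R\<^sup>*"
  shows "terminates_on X ((insert (e, s) R)\<inverse>)"
proof -
  have "(insert (e, s) R)\<inverse> = insert (s, e) (R\<inverse>)" by auto
  then show ?thesis using terminates_on_insert[of X "R\<inverse>" e s] assms
    by (simp add: rtrancl_converse)
qed

lemma terminates_on_isolated_edges:
  assumes "\<And>x. x \<in> X \<Longrightarrow> x \<notin> Domain R \<inter> Range R"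
    and "\<And>x y. (x, y) \<in> R \<Longrightarrow> x \<in> X \<longleftrightarrow> y \<in> X"
  shows "terminates_on X R"
  unfolding terminates_on_def
proof
  fix x assume "x \<in> X"
  show "\<exists>e. (x, e) \<in> R\<^sup>* \<and> e \<notin> Domain R"
  proof (cases "x \<in> Domain R")
    case True
    then obtain y where "(x, y) \<in> R" by auto
    then show ?thesis using assms \<open>x \<in> X\<close> by blast
  qed auto
qed

lemma terminates_on_no_cycle:
  assumes "terminates_on X R" "single_valued R" "x \<in> X"
  shows "(x, x) \<notin> R\<^sup>+"
proof
  assume xx: "(x, x) \<in> R\<^sup>+"
  obtain e where e: "(x, e) \<in> R\<^sup>*" "e \<notin> Domain R"
    using assms by (auto simp: terminates_on_def)
  from e(1) have "(e, x) \<in> R\<^sup>+"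
  proof induction
    case (step y z)
    then obtain z' where "(y, z') \<in> R" "(z', x) \<in> R\<^sup>*" by (meson tranclD)
    then have "(z, x) \<in> R\<^sup>*" using step assms(2) by (metis single_valuedD)
    then show ?case using xx by (rule rtrancl_trancl_trancl)
  qed (use xx in simp)
  then show False using e(2) by (metis Domain.intros tranclD)
qed

lemma rtrancl_comparable:
  assumes "single_valued R" "(x, y) \<in> R\<^sup>*" "(x, z) \<in> R\<^sup>*"
  shows "(y, z) \<in> R\<^sup>* \<or> (z, y) \<in> R\<^sup>*"
  using assms by (rule single_valued_confluent)

text \<open>
  The case of the joining steps in which nothing has to be done: if the start \<open>s\<close> of the path of \<open>y\<close>
  already leads to the end \<open>e\<close> of the path of \<open>x\<close>, then it is one path, since relations that are
  single-valued in both directions do not branch.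
\<close>
lemma same_path_if_ends_joined:
  assumes sv: "single_valued R" "single_valued (R\<inverse>)"
    and e: "(x, e) \<in> R\<^sup>*" "e \<notin> Domain R"
    and s: "(s, y) \<in> R\<^sup>*"
    and se: "(s, e) \<in> R\<^sup>*"
  shows "(x, y) \<in> R\<^sup>* \<or> (y, x) \<in> R\<^sup>*"
proof -
  have "(y, e) \<in> R\<^sup>*"
    using rtrancl_comparable[OF sv(1) s se] rtrancl_not_Domain[OF _ e(2), of y] by auto
  then show ?thesis
    using rtrancl_comparable[OF sv(2), of e y x] e(1) by (auto simp: rtrancl_converse)
qed

text \<open>
  The bookkeeping of a back-and-forth construction: countably many requirements, each of which can
  be met by an extension that stays within \<open>P\<close>, are all met along one increasing sequence.
\<close>
lemma fulfil_requirements: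
  fixes x0 :: "'b :: order"
  assumes "countable Q" and "P x0"
    and ext: "\<And>x q. P x \<Longrightarrow> q \<in> Q \<Longrightarrow> \<exists>y. x \<le> y \<and> P y \<and> q y"
  shows "\<exists>X. X 0 = x0 \<and> (\<forall>n::nat. P (X n) \<and> X n \<le> X (Suc n)) \<and> (\<forall>q\<in>Q. \<exists>n. q (X n))"
proof (cases "Q = {}")
  case True
  then show ?thesis using \<open>P x0\<close> by (intro exI[of _ "\<lambda>_. x0"]) auto
next
  case False
  define q where "q = from_nat_into Q"
  have q: "range q = Q" using False \<open>countable Q\<close> by (simp add: q_def)
  have "\<exists>X. \<forall>n. (P (X n) \<and> (n = 0 \<longrightarrow> X n = x0)) \<and> (X n \<le> X (Suc n) \<and> q n (X (Suc n)))"
  proof (rule dependent_nat_choice)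
    show "\<exists>x. P x \<and> (0 = 0 \<longrightarrow> x = x0)" using \<open>P x0\<close> by auto
    fix x :: 'b and n :: nat assume "P x \<and> (n = 0 \<longrightarrow> x = x0)"
    then show "\<exists>y. (P y \<and> (Suc n = 0 \<longrightarrow> y = x0)) \<and> x \<le> y \<and> q n y"
      using ext[of x "q n"] q by auto
  qed
  then obtain X where "\<And>n. P (X n)" "X 0 = x0" "\<And>n. X n \<le> X (Suc n)" "\<And>n. q n (X (Suc n))"
    by blast
  then show ?thesis using q by (intro exI[of _ X]) blast
qed

definition joined :: "'a rel \<Rightarrow> 'a \<Rightarrow> 'a \<Rightarrow> bool" where
  "joined R x y \<longleftrightarrow> (x, y) \<in> R\<^sup>* \<or> (y, x) \<in> R\<^sup>*"

lemma joined_sym: "joined R x y \<longleftrightarrow> joined R y x"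
  by (auto simp: joined_def)

section \<open>Infinite cycles\<close>

text \<open>
  The intrinsic form of an infinite cycle: up to isomorphism, \<open>f\<close> acts on \<open>X\<close> as the successor map
  on the integers or on the natural numbers, according to whether it maps onto \<open>X\<close>.
\<close>
definition infinite_orbit :: "'a set \<Rightarrow> ('a \<Rightarrow> 'a) \<Rightarrow> bool" where
  "infinite_orbit X f \<longleftrightarrow> X \<noteq> {} \<and> f \<in> X \<rightarrow> X \<and> inj_on f X \<and>
     (\<forall>x\<in>X. \<forall>n>0. (f ^^ n) x \<noteq> x) \<and>
     (\<forall>x\<in>X. \<forall>y\<in>X. \<exists>n. (f ^^ n) x = y \<or> (f ^^ n) y = x)"

lemma funpow_in:
  assumes "f \<in> X \<rightarrow> X" "x \<in> X" shows "(f ^^ n) x \<in> X"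
  using assms by (induction n) auto

lemma inj_on_funpow_on:
  assumes "f \<in> X \<rightarrow> X" "inj_on f X" shows "inj_on (f ^^ n) X"
proof (induction n)
  case (Suc n)
  have "(f ^^ n) ` X \<subseteq> X" using funpow_in[OF assms(1)] by auto
  then have "inj_on f ((f ^^ n) ` X)" using assms(2) inj_on_subset by blast
  then show ?case using comp_inj_on[OF Suc] by (simp add: comp_def)
qed simp

lemma infinite_orbitD:
  assumes "infinite_orbit X f"
  shows "f \<in> X \<rightarrow> X" "inj_on f X" "x \<in> X \<Longrightarrow> (f ^^ n) x \<in> X"
    "x \<in> X \<Longrightarrow> y \<in> X \<Longrightarrow> \<exists>n. (f ^^ n) x = y \<or> (f ^^ n) y = x"
  using assms funpow_in[of f X] unfolding infinite_orbit_def by blast+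

lemma infinite_orbit_funpow_eq:
  assumes "infinite_orbit X f" "x \<in> X" "(f ^^ m) x = (f ^^ n) x"
  shows "m = n"
proof -
  have *: "m' = n'" if "m' \<le> n'" "(f ^^ m') x = (f ^^ n') x" for m' n'
  proof -
    have "(f ^^ n') x = (f ^^ m') ((f ^^ (n' - m')) x)"
      using that(1) by (metis comp_apply funpow_add le_add_diff_inverse)
    moreover have "inj_on (f ^^ m') X" "(f ^^ (n' - m')) x \<in> X"
      using assms inj_on_funpow_on funpow_in by (fastforce simp: infinite_orbit_def)+
    ultimately have "(f ^^ (n' - m')) x = x"
      using that(2) \<open>x \<in> X\<close> by (metis inj_onD)
    then have "n' - m' = 0" using assms by (auto simp: infinite_orbit_def)
    then show ?thesis using that(1) by simp
  qed
  show ?thesis using *[of m n] *[of n m] assms(3) by (metis nat_le_linear)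
qed

lemma infinite_orbit_start_unique:
  assumes "infinite_orbit X f" "x \<in> X - f ` X" "y \<in> X - f ` X"
  shows "x = y"
proof -
  have *: "x = y" if "x \<in> X" "y \<in> X - f ` X" "(f ^^ n) x = y" for x y n
  proof (cases n)
    case (Suc k)
    have "(f ^^ k) x \<in> X" using infinite_orbitD(3)[OF assms(1)] that by blast
    then show ?thesis using that Suc by auto
  qed (use that in auto)
  obtain n where "(f ^^ n) x = y \<or> (f ^^ n) y = x"
    using infinite_orbitD(4)[OF assms(1)] assms(2,3) by blast
  then show ?thesis using *[of x y n] *[of y x n] assms by auto
qed

text \<open>
  The graph of the isomorphism of two infinite orbits that takes \<open>x0\<close> to \<open>y0\<close>. As a relation it is
  symmetric in the two sides, so that totality and uniqueness have to be shown in one direction only.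
\<close>
definition orbit_match :: "('a \<Rightarrow> 'a) \<Rightarrow> 'a \<Rightarrow> ('b \<Rightarrow> 'b) \<Rightarrow> 'b \<Rightarrow> 'a \<Rightarrow> 'b \<Rightarrow> bool" where
  "orbit_match f x0 g y0 x y \<longleftrightarrow>
     (\<exists>n. x = (f ^^ n) x0 \<and> y = (g ^^ n) y0 \<or> (f ^^ n) x = x0 \<and> (g ^^ n) y = y0)"

lemma orbit_match_sym: "orbit_match f x0 g y0 x y \<longleftrightarrow> orbit_match g y0 f x0 y x"
  by (auto simp: orbit_match_def)

lemma orbit_match_unique:
  assumes X: "infinite_orbit X f" and Y: "infinite_orbit Y g" and "x0 \<in> X" "y0 \<in> Y"
    and "x \<in> X" "y \<in> Y" "y' \<in> Y"
    and m: "orbit_match f x0 g y0 x y" and m': "orbit_match f x0 g y0 x y'"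
  shows "y = y'"
proof -
  have eq: "\<And>m n x. x \<in> X \<Longrightarrow> (f ^^ m) x = (f ^^ n) x \<Longrightarrow> m = n"
    using infinite_orbit_funpow_eq[OF X] by blast
  have mixed: "m = 0 \<and> n = 0" if "x = (f ^^ m) x0" "(f ^^ n) x = x0" for m n
    using eq[of x0 "n + m" 0] that \<open>x0 \<in> X\<close> by (simp add: funpow_add)
  have inj: "\<And>n. (g ^^ n) y = (g ^^ n) y' \<Longrightarrow> y = y'"
    using inj_on_funpow_on[of g Y] Y \<open>y \<in> Y\<close> \<open>y' \<in> Y\<close> by (auto simp: infinite_orbit_def inj_on_def)
  obtain n where n: "x = (f ^^ n) x0 \<and> y = (g ^^ n) y0 \<or> (f ^^ n) x = x0 \<and> (g ^^ n) y = y0"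
    using m by (auto simp: orbit_match_def)
  obtain n' where n': "x = (f ^^ n') x0 \<and> y' = (g ^^ n') y0 \<or> (f ^^ n') x = x0 \<and> (g ^^ n') y' = y0"
    using m' by (auto simp: orbit_match_def)
  from n n' show ?thesis
  proof (elim disjE conjE)
    assume "x = (f ^^ n) x0" "x = (f ^^ n') x0" "y = (g ^^ n) y0" "y' = (g ^^ n') y0"
    then show ?thesis using eq[of x0 n n'] \<open>x0 \<in> X\<close> by simp
  next
    assume "x = (f ^^ n) x0" "(f ^^ n') x = x0" "y = (g ^^ n) y0" "(g ^^ n') y' = y0"
    then show ?thesis using mixed[of n n'] by simp
  next
    assume "(f ^^ n) x = x0" "x = (f ^^ n') x0" "(g ^^ n) y = y0" "y' = (g ^^ n') y0"
    then show ?thesis using mixed[of n' n] by simp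
  next
    assume "(f ^^ n) x = x0" "(f ^^ n') x = x0" "(g ^^ n) y = y0" "(g ^^ n') y' = y0"
    then show ?thesis using eq[of x n n'] inj[of n] \<open>x \<in> X\<close> by simp
  qed
qed

text \<open>
  Backwards from the base points one may run out of predecessors. This is excluded either because
  \<open>g\<close> has a predecessor for every point of \<open>Y\<close>, or because \<open>x0\<close> is the first point of its orbit.
\<close>
lemma orbit_match_total:
  assumes X: "infinite_orbit X f" and Y: "infinite_orbit Y g" and x0: "x0 \<in> X" and y0: "y0 \<in> Y"
    and st: "g ` Y = Y \<or> x0 \<notin> f ` X" and x: "x \<in> X"
  shows "\<exists>y\<in>Y. orbit_match f x0 g y0 x y"
proof -
  obtain n where "(f ^^ n) x0 = x \<or> (f ^^ n) x = x0"
    using infinite_orbitD(4)[OF X x0 x] by blast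
  then show ?thesis
  proof
    assume "(f ^^ n) x0 = x"
    moreover have "(g ^^ n) y0 \<in> Y" using infinite_orbitD(3)[OF Y y0] .
    ultimately show ?thesis by (auto simp: orbit_match_def)
  next
    assume n: "(f ^^ n) x = x0"
    from st show ?thesis
    proof
      assume "g ` Y = Y"
      then have "(g ^^ n) ` Y = Y"
        by (induction n) (simp_all only: funpow.simps image_comp[symmetric] image_id id_apply)
      then obtain y where "y \<in> Y" "(g ^^ n) y = y0" using y0 by (metis imageE)
      then show ?thesis using n by (auto simp: orbit_match_def)
    next
      assume "x0 \<notin> f ` X"
      moreover have "(f ^^ k) x \<in> X" for k using infinite_orbitD(3)[OF X x] .
      ultimately have "n = 0" using n by (cases n) auto
      then have "x = x0" using n by simp
      then have "x = (f ^^ 0) x0 \<and> y0 = (g ^^ 0) y0" by simp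
      then show ?thesis using y0 unfolding orbit_match_def by blast
    qed
  qed
qed

text \<open>
  One takes the first points as base points if there are any, and arbitrary ones otherwise.
\<close>
lemma infinite_orbits_isomorphic:
  assumes X: "infinite_orbit X f" and Y: "infinite_orbit Y g"
    and st: "f ` X = X \<longleftrightarrow> g ` Y = Y"
  shows "\<exists>\<theta>. bij_betw \<theta> X Y \<and> (\<forall>x\<in>X. \<theta> (f x) = g (\<theta> x))"
proof -
  have sub: "f ` X \<subseteq> X" "g ` Y \<subseteq> Y" using X Y by (auto simp: infinite_orbit_def)
  obtain x0 y0 where x0: "x0 \<in> X" and y0: "y0 \<in> Y"
    and s: "g ` Y = Y \<or> x0 \<notin> f ` X" "f ` X = X \<or> y0 \<notin> g ` Y"
  proof (cases "f ` X = X")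
    case True
    then show ?thesis using that X Y st by (auto simp: infinite_orbit_def)
  next
    case False
    then obtain x y where "x \<in> X - f ` X" "y \<in> Y - g ` Y" using sub st by blast
    then show ?thesis using that[of x y] by auto
  qed
  let ?M = "orbit_match f x0 g y0"
  have "\<forall>x\<in>X. \<exists>y. y \<in> Y \<and> ?M x y"
    using orbit_match_total[OF X Y x0 y0 s(1)] by blast
  then obtain \<theta> where \<theta>: "\<And>x. x \<in> X \<Longrightarrow> \<theta> x \<in> Y \<and> ?M x (\<theta> x)" by (metis bchoice)
  have uniq: "\<theta> x = y" if "x \<in> X" "y \<in> Y" "?M x y" for x y
    using orbit_match_unique[OF X Y x0 y0] that \<theta> by blast
  have uniq': "x = x'" if "x \<in> X" "x' \<in> X" "y \<in> Y" "?M x y" "?M x' y" for x x' y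
    using orbit_match_unique[OF Y X y0 x0 that(3) that(1,2)] that(4,5)
    unfolding orbit_match_sym[of f] by blast
  have "bij_betw \<theta> X Y"
  proof (rule bij_betw_imageI)
    show "inj_on \<theta> X" using uniq' \<theta> by (metis inj_onI)
    show "\<theta> ` X = Y"
    proof (intro equalityI subsetI)
      fix y assume "y \<in> Y"
      then obtain x where "x \<in> X" "?M x y"
        using orbit_match_total[OF Y X y0 x0 s(2)] unfolding orbit_match_sym[of g] by blast
      then show "y \<in> \<theta> ` X" using uniq \<open>y \<in> Y\<close> by blast
    qed (use \<theta> in auto)
  qed
  moreover have "\<theta> (f x) = g (\<theta> x)" if x: "x \<in> X" for x
  proof (rule uniq)
    show "f x \<in> X" "g (\<theta> x) \<in> Y" using sub \<theta> x by auto
    obtain n where "x = (f ^^ n) x0 \<and> \<theta> x = (g ^^ n) y0 \<or> (f ^^ n) x = x0 \<and> (g ^^ n) (\<theta> x) = y0"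
      using \<theta>[OF x] by (auto simp: orbit_match_def)
    then show "?M (f x) (g (\<theta> x))"
    proof
      assume "x = (f ^^ n) x0 \<and> \<theta> x = (g ^^ n) y0"
      then have "f x = (f ^^ Suc n) x0 \<and> g (\<theta> x) = (g ^^ Suc n) y0" by (metis comp_apply funpow.simps(2))
      then show ?thesis unfolding orbit_match_def by blast
    next
      assume a: "(f ^^ n) x = x0 \<and> (g ^^ n) (\<theta> x) = y0"
      show ?thesis
      proof (cases n)
        case 0
        then have "f x = (f ^^ 1) x0 \<and> g (\<theta> x) = (g ^^ 1) y0" using a by auto
        then show ?thesis unfolding orbit_match_def by blast
      next
        case (Suc k)
        then have "(f ^^ k) (f x) = x0 \<and> (g ^^ k) (g (\<theta> x)) = y0"
          using a by (simp add: funpow_swap1)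
        then show ?thesis unfolding orbit_match_def by blast
      qed
    qed
  qed
  ultimately show ?thesis by blast
qed

text \<open>
  By minimality \<open>C\<close> equals the set of all forward and backward iterates of any of its points, and if
  some point were periodic, this set would be finite.
\<close>
lemma infinite_cycle_orbit:
  assumes f: "f \<in> Inj \<Omega>" and C: "cycle_under \<Omega> f C" "infinite C"
  shows "infinite_orbit C f"
proof -
  have sub: "C \<subseteq> \<Omega>" and ne: "C \<noteq> {}"
    and inv: "\<And>x. x \<in> \<Omega> \<Longrightarrow> f x \<in> C \<longleftrightarrow> x \<in> C"
    using C unfolding cycle_under_def invariant_under_def by blast+
  have minimal: "\<And>D. D \<noteq> {} \<Longrightarrow> D \<subset> C \<Longrightarrow> \<not> invariant_under \<Omega> f D"
    using C unfolding cycle_under_def by blast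
  have fC: "f \<in> C \<rightarrow> C" using inv sub by auto
  have injC: "inj_on f C" using f sub inj_on_subset by (auto simp: Inj_def)
  have conn: "\<exists>n. (f ^^ n) x = y \<or> (f ^^ n) y = x" if x: "x \<in> C" and y: "y \<in> C" for x y
  proof -
    define D where "D = {y \<in> C. \<exists>n. (f ^^ n) x = y \<or> (f ^^ n) y = x}"
    have "invariant_under \<Omega> f D"
      unfolding invariant_under_def
    proof
      fix y assume "y \<in> \<Omega>"
      show "f y \<in> D \<longleftrightarrow> y \<in> D"
      proof
        assume "y \<in> D"
        then obtain n where n: "y \<in> C" "(f ^^ n) x = y \<or> (f ^^ n) y = x" by (auto simp: D_def)
        have "\<exists>n. (f ^^ n) x = f y \<or> (f ^^ n) (f y) = x"
        proof (cases "(f ^^ n) x = y")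
          case True
          then show ?thesis by (intro exI[of _ "Suc n"]) auto
        next
          case False
          then have ny: "(f ^^ n) y = x" using n by simp
          show ?thesis
          proof (cases n)
            case 0
            then show ?thesis using ny by (intro exI[of _ 1]) auto
          next
            case (Suc k)
            then show ?thesis using ny by (intro exI[of _ k]) (auto simp: funpow_swap1)
          qed
        qed
        then show "f y \<in> D" using n fC by (auto simp: D_def)
      next
        assume "f y \<in> D"
        then obtain n where n: "f y \<in> C" "(f ^^ n) x = f y \<or> (f ^^ n) (f y) = x"
          by (auto simp: D_def)
        have yC: "y \<in> C" using n inv \<open>y \<in> \<Omega>\<close> by auto
        have "\<exists>n. (f ^^ n) x = y \<or> (f ^^ n) y = x"
        proof (cases "(f ^^ n) (f y) = x")
          case True
          then show ?thesis by (intro exI[of _ "Suc n"]) (auto simp: funpow_swap1)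
        next
          case False
          then have ny: "(f ^^ n) x = f y" using n by simp
          show ?thesis
          proof (cases n)
            case 0
            then show ?thesis using ny by (intro exI[of _ 1]) auto
          next
            case (Suc k)
            then have "f ((f ^^ k) x) = f y" using ny by simp
            then have "(f ^^ k) x = y"
              using injC yC funpow_in[OF fC x] by (auto dest: inj_onD)
            then show ?thesis by blast
          qed
        qed
        then show "y \<in> D" using yC by (auto simp: D_def)
      qed
    qed
    moreover have "x \<in> D" using x by (auto simp: D_def intro: exI[of _ 0])
    ultimately have "D = C" using minimal[of D] by (auto simp: D_def)
    then show ?thesis using y by (auto simp: D_def)
  qed
  moreover have "(f ^^ n) x \<noteq> x" if x: "x \<in> C" and "n > 0" for x n
  proof
    assume per: "(f ^^ n) x = x"
    have per_mult: "(f ^^ (n * m)) x = x" for m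
      by (induction m) (auto simp: funpow_add per)
    have "C \<subseteq> (\<lambda>k. (f ^^ k) x) ` {..<n}"
    proof
      fix y assume y: "y \<in> C"
      have "\<exists>k. (f ^^ k) x = y"
      proof -
        obtain m where "(f ^^ m) x = y \<or> (f ^^ m) y = x" using conn[OF x y] by blast
        then show ?thesis
        proof
          assume m: "(f ^^ m) y = x"
          have "n * m = m + (n * m - m)" using \<open>n > 0\<close> by auto
          then have "(f ^^ m) ((f ^^ (n * m - m)) x) = (f ^^ m) y"
            using per_mult[of m] m by (metis comp_apply funpow_add)
          then show ?thesis
            using inj_onD[OF inj_on_funpow_on[OF fC injC, of m] _ funpow_in[OF fC x] y] by blast
        qed blast
      qed
      then obtain k where k: "(f ^^ k) x = y" by blast
      have "(f ^^ k) x = (f ^^ (k mod n)) ((f ^^ (n * (k div n))) x)"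
        by (metis comp_apply funpow_add mod_mult_div_eq)
      then have "(f ^^ (k mod n)) x = y" using k per_mult by simp
      then show "y \<in> (\<lambda>k. (f ^^ k) x) ` {..<n}" using \<open>n > 0\<close> by force
    qed
    then show False using C(2) finite_surj by blast
  qed
  ultimately show ?thesis using fC injC ne by (auto simp: infinite_orbit_def)
qed

text \<open>
  The approximations \<open>R n\<close> of the graph of \<open>f\<close> have no cycles, and a cycle of \<open>f\<close> would already
  occur in one of them. Hence requirements on connectedness alone force a single infinite orbit.
\<close>
lemma infinite_orbit_limit:
  fixes R :: "nat \<Rightarrow> 'a rel"
  assumes inc: "\<And>n. R n \<subseteq> R (Suc n)" and sv: "\<And>n. single_valued (R n)"
    and fin: "\<And>n. terminates_on X (R n)"
    and X: "X \<noteq> {}" "f \<in> X \<rightarrow> X" "inj_on f X"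
    and graph: "\<And>x. x \<in> X \<Longrightarrow> \<exists>n. (x, f x) \<in> R n"
    and conn: "\<And>x y. x \<in> X \<Longrightarrow> y \<in> X \<Longrightarrow> \<exists>n. joined (R n) x y"
  shows "infinite_orbit X f"
proof -
  have le: "R m \<subseteq> R n" if "m \<le> n" for m n
    using lift_Suc_mono_le[of R, OF inc that] .
  have R_f: "y = f x" if "(x, y) \<in> R n" and x: "x \<in> X" for x y n
  proof -
    obtain m where "(x, f x) \<in> R m" using graph[OF x] by blast
    then have "(x, f x) \<in> R (max m n)" "(x, y) \<in> R (max m n)"
      using le[of m "max m n"] le[of n "max m n"] that(1) by auto
    then show ?thesis using sv by (metis single_valuedD)
  qed
  have path: "\<exists>k. (f ^^ k) x = y" if p: "(x, y) \<in> (R n)\<^sup>*" and x: "x \<in> X" for x y n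
    using p
  proof induction
    case (step y z)
    then obtain k where k: "(f ^^ k) x = y" by blast
    then have "y \<in> X" using funpow_in[OF X(2) x] by auto
    then have "(f ^^ Suc k) x = z" using R_f step(2) k by auto
    then show ?case by blast
  qed (auto intro: exI[of _ 0])
  have orbit: "\<exists>n. (x, (f ^^ k) x) \<in> (R n)\<^sup>*" if x: "x \<in> X" for x k
  proof (induction k)
    case (Suc k)
    then obtain m where m: "(x, (f ^^ k) x) \<in> (R m)\<^sup>*" by blast
    obtain n where n: "((f ^^ k) x, f ((f ^^ k) x)) \<in> R n"
      using graph[OF funpow_in[OF X(2) x]] by blast
    have "(x, (f ^^ k) x) \<in> (R (max m n))\<^sup>*"
      using m rtrancl_mono[OF le[of m "max m n"]] by auto
    moreover have "((f ^^ k) x, f ((f ^^ k) x)) \<in> R (max m n)"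
      using n le[of n "max m n"] by auto
    ultimately have "(x, (f ^^ Suc k) x) \<in> (R (max m n))\<^sup>*" by simp
    then show ?case by blast
  qed auto
  have "(f ^^ k) x \<noteq> x" if x: "x \<in> X" and k: "k > 0" for x k
  proof
    assume "(f ^^ k) x = x"
    moreover obtain j where j: "k = Suc j" using k by (cases k) auto
    ultimately have fx: "(f ^^ j) (f x) = x" by (simp add: funpow_swap1)
    have "f x \<in> X" using X(2) x by auto
    then obtain m where m: "(f x, x) \<in> (R m)\<^sup>*" using orbit[of "f x" j] fx by auto
    obtain n where n: "(x, f x) \<in> R n" using graph[OF x] by blast
    have "(f x, x) \<in> (R (max m n))\<^sup>*" "(x, f x) \<in> R (max m n)"
      using m n le[of n "max m n"] rtrancl_mono[OF le[of m "max m n"]] by auto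
    then have "(x, x) \<in> (R (max m n))\<^sup>+" by (rule rtrancl_into_trancl2[rotated])
    then show False using terminates_on_no_cycle[OF fin sv x] by blast
  qed
  moreover have "\<exists>n. (f ^^ n) x = y \<or> (f ^^ n) y = x" if x: "x \<in> X" and y: "y \<in> X" for x y
  proof -
    obtain n where "joined (R n) x y" using conn[OF x y] by blast
    then show ?thesis using path[of x y n] path[of y x n] x y unfolding joined_def by blast
  qed
  ultimately show ?thesis using X by (auto simp: infinite_orbit_def)
qed

text \<open>
  This is how conjugacy is established for both factors: the part outside one infinite cycle is
  matched by construction through \<open>\<alpha>\<close>, and what remains is isomorphic as soon as it is a single
  infinite orbit of the same kind (onto or not).
\<close>
lemma glue_conjugation:
  assumes C: "C \<subseteq> \<Omega>" and A: "A \<subseteq> \<Omega>" and inv: "\<And>x. x \<in> \<Omega> \<Longrightarrow> f x \<in> \<Omega> \<and> (f x \<in> C \<longleftrightarrow> x \<in> C)"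
    and \<alpha>: "bij_betw \<alpha> (\<Omega> - C) A" "\<And>x. x \<in> \<Omega> - C \<Longrightarrow> \<alpha> (f x) = F (\<alpha> x)"
    and orb: "infinite_orbit C f" "infinite_orbit (\<Omega> - A) F" "f ` C = C \<longleftrightarrow> F ` (\<Omega> - A) = \<Omega> - A"
  shows "\<exists>\<theta>. \<theta> permutes \<Omega> \<and> (\<forall>x\<in>\<Omega>. \<theta> (f x) = F (\<theta> x))"
proof -
  obtain \<gamma> where \<gamma>: "bij_betw \<gamma> C (\<Omega> - A)" "\<And>x. x \<in> C \<Longrightarrow> \<gamma> (f x) = F (\<gamma> x)"
    using infinite_orbits_isomorphic[OF orb] by blast
  define \<theta> where "\<theta> x = (if x \<in> C then \<gamma> x else if x \<in> \<Omega> then \<alpha> x else x)" for x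
  have "bij_betw \<theta> C (\<Omega> - A)" using \<gamma>(1) by (rule bij_betw_cong[THEN iffD1, rotated]) (simp add: \<theta>_def)
  moreover have "bij_betw \<theta> (\<Omega> - C) A"
    using \<alpha>(1) by (rule bij_betw_cong[THEN iffD1, rotated]) (simp add: \<theta>_def)
  ultimately have "bij_betw \<theta> (C \<union> (\<Omega> - C)) ((\<Omega> - A) \<union> A)" by (rule bij_betw_combine) auto
  moreover have "C \<union> (\<Omega> - C) = \<Omega>" "(\<Omega> - A) \<union> A = \<Omega>" using C A by auto
  ultimately have "\<theta> permutes \<Omega>" using C by (intro bij_imp_permutes) (auto simp: \<theta>_def)
  moreover have "\<theta> (f x) = F (\<theta> x)" if "x \<in> \<Omega>" for x
    using inv[OF that] that \<alpha>(2) \<gamma>(2) by (auto simp: \<theta>_def)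
  ultimately show ?thesis by blast
qed

section \<open>Building the factorization by successive approximation\<close>

text \<open>
  The approximations are relations \<open>\<Sigma> \<subseteq> W \<times> \<Omega>\<close> that describe part of a bijection
  \<open>\<sigma> : W \<rightarrow> \<Omega>\<close>. The second factor \<open>\<sigma>\<^sup>-\<^sup>1\<close> has the edges \<open>\<Sigma>\<inverse>\<close>, and the first factor \<open>\<sigma> \<circ> h\<close> has the edges
  \<open>induced \<Sigma>\<close> defined below. On \<open>A\<close> the first factor and on \<open>B\<close> the second one are completely prescribed
  from the beginning; outside \<open>A\<close> and \<open>B\<close>, respectively, they are to become one infinite orbit.
  Points outside \<open>W\<close> have no predecessor under the second factor; the last assumption says
  that at most one of them is left for its infinite orbit.
\<close>
locale linking =
  fixes \<Omega> W A B :: "'a set" and h :: "'a \<Rightarrow> 'a"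
  assumes countable: "countable \<Omega>"
    and inj_h: "inj_on h \<Omega>" and hW: "h ` \<Omega> \<subseteq> W" and W: "W \<subseteq> \<Omega>"
    and A: "A \<subseteq> \<Omega>" and B: "B \<subseteq> \<Omega>"
    and free_start: "\<And>z z'. z \<in> \<Omega> - W - B \<Longrightarrow> z' \<in> \<Omega> - W - B \<Longrightarrow> z = z'"
begin

definition induced :: "'a rel \<Rightarrow> 'a rel" where
  "induced \<Sigma> = {(z, u). z \<in> \<Omega> \<and> (h z, u) \<in> \<Sigma>}"

text \<open>
  A supply of points which the approximation does not touch: for fresh \<open>u\<close>, neither \<open>u\<close> nor \<open>h u\<close> has an
  edge of the second factor, \<open>u\<close> has no edge of the first factor, and no edge of the first factor
  leaves \<open>h u\<close>. The condition \<open>h u \<noteq> u\<close> is where the infinite support of \<open>h\<close> enters: the joining steps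
  insert \<open>u\<close> and \<open>h u\<close> as two different points.
\<close>
definition fresh :: "'a rel \<Rightarrow> 'a set" where
  "fresh \<Sigma> = {u \<in> \<Omega>. h u \<noteq> u \<and> u \<notin> Range \<Sigma> \<and> h u \<notin> Range \<Sigma> \<and>
     u \<notin> Domain \<Sigma> \<and> h u \<notin> Domain \<Sigma> \<and> h (h u) \<notin> Domain \<Sigma>}"

text \<open>
  The parts of the invariant are, in order: \<open>\<Sigma>\<close> is a partial bijection; the first factor is
  complete on \<open>A\<close> and respects it, and so does the second factor on \<open>B\<close>; outside these sets all
  paths are finite; fresh points never run out; and at most one point of \<open>W - h ` \<Omega>\<close> is left for the
  infinite orbit of the first factor. Such a point \<open>w\<close> makes \<open>\<sigma> w\<close> a point without predecessor under
  the first factor, and a single infinite orbit can contain only one of these.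
\<close>
definition admissible :: "'a rel \<Rightarrow> bool" where
  "admissible \<Sigma> \<longleftrightarrow>
     \<Sigma> \<subseteq> W \<times> \<Omega> \<and> single_valued \<Sigma> \<and> single_valued (\<Sigma>\<inverse>) \<and>
     A \<subseteq> Range \<Sigma> \<and> h ` A \<subseteq> Domain \<Sigma> \<and> (\<forall>(z, u)\<in>induced \<Sigma>. z \<in> A \<longleftrightarrow> u \<in> A) \<and>
     B \<subseteq> Range \<Sigma> \<and> B \<inter> W \<subseteq> Domain \<Sigma> \<and> (\<forall>(w, u)\<in>\<Sigma>. w \<in> B \<longleftrightarrow> u \<in> B) \<and>
     terminates_on (\<Omega> - A) (induced \<Sigma>) \<and> terminates_on (\<Omega> - A) ((induced \<Sigma>)\<inverse>) \<and>
     terminates_on (\<Omega> - B) (\<Sigma>\<inverse>) \<and> terminates_on (\<Omega> - B) \<Sigma> \<and>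
     infinite (fresh \<Sigma>) \<and>
     (\<forall>w \<in> W - h ` \<Omega> - \<Sigma>\<inverse> `` A. \<forall>w' \<in> W - h ` \<Omega> - \<Sigma>\<inverse> `` A. w = w')"

lemma admissibleD:
  assumes "admissible \<Sigma>"
  shows "\<Sigma> \<subseteq> W \<times> \<Omega>" "single_valued \<Sigma>" "single_valued (\<Sigma>\<inverse>)"
    "A \<subseteq> Range \<Sigma>" "h ` A \<subseteq> Domain \<Sigma>"
    "(z, u) \<in> induced \<Sigma> \<Longrightarrow> z \<in> A \<longleftrightarrow> u \<in> A"
    "B \<subseteq> Range \<Sigma>" "B \<inter> W \<subseteq> Domain \<Sigma>" "(w, u) \<in> \<Sigma> \<Longrightarrow> w \<in> B \<longleftrightarrow> u \<in> B"
    "terminates_on (\<Omega> - A) (induced \<Sigma>)" "terminates_on (\<Omega> - A) ((induced \<Sigma>)\<inverse>)"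
    "terminates_on (\<Omega> - B) (\<Sigma>\<inverse>)" "terminates_on (\<Omega> - B) \<Sigma>"
    "infinite (fresh \<Sigma>)"
    "w \<in> W - h ` \<Omega> - \<Sigma>\<inverse> `` A \<Longrightarrow> w' \<in> W - h ` \<Omega> - \<Sigma>\<inverse> `` A \<Longrightarrow> w = w'"
  using assms unfolding admissible_def by blast+

lemma single_valued_induced: "single_valued \<Sigma> \<Longrightarrow> single_valued (induced \<Sigma>)"
  by (auto simp: single_valued_def induced_def)

lemma single_valued_induced_converse:
  "single_valued (\<Sigma>\<inverse>) \<Longrightarrow> single_valued ((induced \<Sigma>)\<inverse>)"
  using inj_h by (auto simp: single_valued_def induced_def inj_on_def)

lemma induced_insert:
  assumes "z \<in> \<Omega>"
  shows "induced (insert (h z, u) \<Sigma>) = insert (z, u) (induced \<Sigma>)"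
  using assms inj_h by (auto simp: induced_def inj_on_def)

lemma induced_insert_outside:
  assumes "w \<notin> h ` \<Omega>"
  shows "induced (insert (w, u) \<Sigma>) = induced \<Sigma>"
  using assms by (auto simp: induced_def)

lemma Domain_induced: "z \<in> Domain (induced \<Sigma>) \<longleftrightarrow> z \<in> \<Omega> \<and> h z \<in> Domain \<Sigma>"
  by (auto simp: induced_def)

lemma Range_induced: "Range (induced \<Sigma>) \<subseteq> Range \<Sigma>"
  by (auto simp: induced_def)

lemma finite_vimage_on: "finite F \<Longrightarrow> finite {u \<in> \<Omega>. h u \<in> F}"
  using finite_vimage_IntI[OF _ inj_h, of F] by (rule finite_subset[rotated]) auto

lemma fresh_insert: "fresh \<Sigma> - {u. u \<in> {x, w}} - {u\<in>\<Omega>. h u \<in> {x, w}} - {u\<in>\<Omega>. h u \<in> {u\<in>\<Omega>. h u \<in> {w}}}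
   \<subseteq> fresh (insert (w, x) \<Sigma>)"
  using hW W by (auto simp: fresh_def)

lemma infinite_fresh_insert: "infinite (fresh \<Sigma>) \<Longrightarrow> infinite (fresh (insert (w, x) \<Sigma>))"
proof -
  assume "infinite (fresh \<Sigma>)"
  moreover have "finite {u. u \<in> {x, w}}" "finite {u\<in>\<Omega>. h u \<in> {x, w}}"
    "finite {u\<in>\<Omega>. h u \<in> {u\<in>\<Omega>. h u \<in> {w}}}"
    by (intro finite_vimage_on finite.intros | simp)+
  ultimately show ?thesis
    using infinite_super[OF fresh_insert] by simp
qed

lemma obtain_fresh:
  assumes "admissible \<Sigma>" "finite F"
  obtains u where "u \<in> fresh \<Sigma>" "u \<notin> F" "h u \<notin> F" "h (h u) \<notin> F"
proof -
  let ?F = "F \<union> {u\<in>\<Omega>. h u \<in> F} \<union> {u\<in>\<Omega>. h u \<in> {u\<in>\<Omega>. h u \<in> F}}"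
  have "finite ?F" using assms(2) by (intro finite_UnI finite_vimage_on)
  then have "infinite (fresh \<Sigma> - ?F)" using admissibleD(14)[OF assms(1)] by simp
  then have "fresh \<Sigma> - ?F \<noteq> {}" by (rule infinite_imp_nonempty)
  then obtain u where u: "u \<in> fresh \<Sigma> - ?F" by blast
  then have "u \<in> \<Omega>" by (simp add: fresh_def)
  then have "h u \<in> \<Omega>" using hW W by auto
  show ?thesis using that[of u] u \<open>u \<in> \<Omega>\<close> \<open>h u \<in> \<Omega>\<close> by simp
qed

lemma freshD:
  assumes "u \<in> fresh \<Sigma>"
  shows "u \<in> \<Omega>" "h u \<in> W" "h u \<in> \<Omega>" "h u \<noteq> u"
    "u \<notin> Range \<Sigma>" "h u \<notin> Range \<Sigma>"
    "u \<notin> Domain \<Sigma>" "h u \<notin> Domain \<Sigma>" "h (h u) \<notin> Domain \<Sigma>"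
  using assms hW W by (auto simp: fresh_def)

text \<open>
  The only extension step ever used. A new pair \<open>(w, u)\<close> adds the edge from \<open>u\<close> to \<open>w\<close> to the second
  factor and, if \<open>w = h z\<close>, the edge from \<open>z\<close> to \<open>u\<close> to the first; the last two premises say that neither
  edge closes a cycle.
\<close>
lemma admissible_insert:
  assumes adm: "admissible \<Sigma>" and w: "w \<in> W" "w \<notin> Domain \<Sigma>" and u: "u \<in> \<Omega>" "u \<notin> Range \<Sigma>"
    and wu: "(w, u) \<notin> (\<Sigma>\<inverse>)\<^sup>*"
    and uz: "\<And>z. z \<in> \<Omega> \<Longrightarrow> h z = w \<Longrightarrow> (u, z) \<notin> (induced \<Sigma>)\<^sup>*"
  shows "admissible (insert (w, u) \<Sigma>)"
proof -
  note D = admissibleD[OF adm]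
  let ?S = "insert (w, u) \<Sigma>"
  have uA: "u \<notin> A" and uB: "u \<notin> B" using D(4,7) u by auto
  have wB: "w \<notin> B" using D(8) w by auto
  have zA: "z \<notin> A" if "h z = w" for z using D(5) w that by auto
  have paths: "terminates_on (\<Omega> - A) (induced ?S) \<and> terminates_on (\<Omega> - A) ((induced ?S)\<inverse>)"
  proof (cases "w \<in> h ` \<Omega>")
    case True
    then obtain z where z: "z \<in> \<Omega>" "w = h z" by auto
    then show ?thesis
      using terminates_on_insert[OF D(10), of u z] terminates_on_converse_insert[OF D(11), of z u]
        uz[of z] u uA zA[of z] by (auto simp: induced_insert)
  qed (use D(10,11) in \<open>simp add: induced_insert_outside\<close>)
  show ?thesis
    unfolding admissible_def
  proof (intro conjI)
    show "?S \<subseteq> W \<times> \<Omega>" using D(1) w u by auto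
    show "single_valued ?S" "single_valued (?S\<inverse>)"
      using D(2,3) w(2) u(2) by (auto simp: single_valued_def)
    show "A \<subseteq> Range ?S" "h ` A \<subseteq> Domain ?S" "B \<subseteq> Range ?S" "B \<inter> W \<subseteq> Domain ?S"
      using D(4,5,7,8) by auto
    show "\<forall>(z, x)\<in>induced ?S. z \<in> A \<longleftrightarrow> x \<in> A"
    proof (intro ballI, clarify)
      fix z x assume "(z, x) \<in> induced ?S"
      then show "z \<in> A \<longleftrightarrow> x \<in> A" using D(6)[of z x] uA zA[of z] by (auto simp: induced_def)
    qed
    show "\<forall>(w', x)\<in>?S. w' \<in> B \<longleftrightarrow> x \<in> B" using D(9) uB wB by blast
    show "terminates_on (\<Omega> - A) (induced ?S)" "terminates_on (\<Omega> - A) ((induced ?S)\<inverse>)"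
      using paths by auto
    have "?S\<inverse> = insert (u, w) (\<Sigma>\<inverse>)" by auto
    then show "terminates_on (\<Omega> - B) (?S\<inverse>)"
      using terminates_on_insert[OF D(12) _ wu] w W wB by auto
    show "terminates_on (\<Omega> - B) ?S"
      using terminates_on_insert[OF D(13), of u w] wu u uB by (auto simp: rtrancl_converse)
    show "infinite (fresh ?S)" by (rule infinite_fresh_insert) (rule D(14))
    show "\<forall>v \<in> W - h ` \<Omega> - ?S\<inverse> `` A. \<forall>v' \<in> W - h ` \<Omega> - ?S\<inverse> `` A. v = v'"
      using D(15) by blast
  qed
qed

lemma extend_Domain:
  assumes adm: "admissible \<Sigma>" and w: "w \<in> W"
  shows "\<exists>\<Sigma>'. \<Sigma> \<subseteq> \<Sigma>' \<and> admissible \<Sigma>' \<and> w \<in> Domain \<Sigma>'"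
proof (cases "w \<in> Domain \<Sigma>")
  case False
  obtain u where uF: "u \<in> fresh \<Sigma>" "u \<notin> {w}" "h u \<notin> {w}" "h (h u) \<notin> {w}"
    by (rule obtain_fresh[OF adm, of "{w}"]) auto
  note u = uF(2-) freshD[OF uF(1)]
  have "admissible (insert (w, u) \<Sigma>)"
  proof (rule admissible_insert[OF adm w False])
    show "(w, u) \<notin> (\<Sigma>\<inverse>)\<^sup>*" using rtrancl_not_Range[of w u "\<Sigma>\<inverse>"] u by auto
    show "(u, z) \<notin> (induced \<Sigma>)\<^sup>*" if "z \<in> \<Omega>" "h z = w" for z
      using rtrancl_not_Domain[of u z "induced \<Sigma>"] u that by (auto simp: Domain_induced)
  qed (use u in auto)
  then show ?thesis by (intro exI[of _ "insert (w, u) \<Sigma>"]) auto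
qed (use adm in auto)

lemma extend_Range:
  assumes adm: "admissible \<Sigma>" and z: "z \<in> \<Omega>"
  shows "\<exists>\<Sigma>'. \<Sigma> \<subseteq> \<Sigma>' \<and> admissible \<Sigma>' \<and> z \<in> Range \<Sigma>'"
proof (cases "z \<in> Range \<Sigma>")
  case False
  obtain u where uF: "u \<in> fresh \<Sigma>" "u \<notin> {z}" "h u \<notin> {z}" "h (h u) \<notin> {z}"
    by (rule obtain_fresh[OF adm, of "{z}"]) auto
  note u = uF(2-) freshD[OF uF(1)]
  have "admissible (insert (h u, z) \<Sigma>)"
  proof (rule admissible_insert[OF adm _ _ z False])
    show "(h u, z) \<notin> (\<Sigma>\<inverse>)\<^sup>*" using rtrancl_not_Domain[of "h u" z "\<Sigma>\<inverse>"] u by auto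
    show "(z, t) \<notin> (induced \<Sigma>)\<^sup>*" if "t \<in> \<Omega>" "h t = h u" for t
    proof -
      have "t = u" using that u inj_h by (auto simp: inj_on_def)
      then show ?thesis using rtrancl_not_Range[of z u "induced \<Sigma>"] u Range_induced by blast
    qed
  qed (use u in auto)
  then show ?thesis by (intro exI[of _ "insert (h u, z) \<Sigma>"]) auto
qed (use adm in auto)

lemma path_outside_A:
  assumes "admissible \<Sigma>" "(x, y) \<in> (induced \<Sigma>)\<^sup>*"
  shows "x \<in> A \<longleftrightarrow> y \<in> A"
  using assms(2) by induction (use admissibleD(6)[OF assms(1)] in auto)

lemma path_outside_B:
  assumes "admissible \<Sigma>" "(x, y) \<in> (\<Sigma>\<inverse>)\<^sup>*"
  shows "x \<in> B \<longleftrightarrow> y \<in> B"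
  using assms(2) by induction (use admissibleD(9)[OF assms(1)] in auto)

lemma path_in_\<Omega>:
  assumes "admissible \<Sigma>"
  shows "(x, y) \<in> (induced \<Sigma>)\<^sup>* \<Longrightarrow> x \<in> \<Omega> \<longleftrightarrow> y \<in> \<Omega>" "(x, y) \<in> (\<Sigma>\<inverse>)\<^sup>* \<Longrightarrow> x \<in> \<Omega> \<longleftrightarrow> y \<in> \<Omega>"
proof -
  show "(x, y) \<in> (induced \<Sigma>)\<^sup>* \<Longrightarrow> x \<in> \<Omega> \<longleftrightarrow> y \<in> \<Omega>"
    by (induction rule: rtrancl_induct) (use admissibleD(1)[OF assms] in \<open>auto simp: induced_def\<close>)
  show "(x, y) \<in> (\<Sigma>\<inverse>)\<^sup>* \<Longrightarrow> x \<in> \<Omega> \<longleftrightarrow> y \<in> \<Omega>"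
    by (induction rule: rtrancl_induct) (use admissibleD(1)[OF assms] W in auto)
qed

text \<open>
  The direct link \<open>(h e, s)\<close> might close a cycle of the second factor. Going through a fresh point \<open>u\<close>,
  that is from \<open>e\<close> to \<open>u\<close> to \<open>s\<close>, avoids this: the second factor then only acquires edges from \<open>u\<close> to \<open>h e\<close>
  and from \<open>s\<close> to \<open>h u\<close>, and the distinct points \<open>u\<close> and \<open>h u\<close> were isolated in it.
\<close>
lemma join_induced_ends:
  assumes adm: "admissible \<Sigma>"
    and e: "e \<in> \<Omega>" "h e \<notin> Domain \<Sigma>" and s: "s \<in> \<Omega>" "s \<notin> Range \<Sigma>"
    and se: "(s, e) \<notin> (induced \<Sigma>)\<^sup>*"
  shows "\<exists>\<Sigma>'. \<Sigma> \<subseteq> \<Sigma>' \<and> admissible \<Sigma>' \<and> (e, s) \<in> (induced \<Sigma>')\<^sup>*"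
proof -
  obtain u where uF: "u \<in> fresh \<Sigma>" "u \<notin> {e, s, h e}" "h u \<notin> {e, s, h e}" "h (h u) \<notin> {e, s, h e}"
    by (rule obtain_fresh[OF adm, of "{e, s, h e}"]) auto
  note u = uF(2-) freshD[OF uF(1)]
  define \<Sigma>1 where "\<Sigma>1 = insert (h u, s) \<Sigma>"
  have ind1: "induced \<Sigma>1 = insert (u, s) (induced \<Sigma>)"
    unfolding \<Sigma>1_def using u by (intro induced_insert) auto
  have adm1: "admissible \<Sigma>1"
    unfolding \<Sigma>1_def
  proof (rule admissible_insert[OF adm])
    show "(h u, s) \<notin> (\<Sigma>\<inverse>)\<^sup>*" using rtrancl_not_Domain[of "h u" s "\<Sigma>\<inverse>"] u by auto
    show "(s, t) \<notin> (induced \<Sigma>)\<^sup>*" if "t \<in> \<Omega>" "h t = h u" for t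
    proof -
      have "t = u" using that u inj_h by (auto simp: inj_on_def)
      then show ?thesis using rtrancl_not_Range[of s u "induced \<Sigma>"] u Range_induced by blast
    qed
  qed (use u s in auto)
  define \<Sigma>2 where "\<Sigma>2 = insert (h e, u) \<Sigma>1"
  have adm2: "admissible \<Sigma>2"
    unfolding \<Sigma>2_def
  proof (rule admissible_insert[OF adm1])
    show "(h e, u) \<notin> (\<Sigma>1\<inverse>)\<^sup>*" using rtrancl_not_Range[of "h e" u "\<Sigma>1\<inverse>"] u by (auto simp: \<Sigma>1_def)
    show "(u, t) \<notin> (induced \<Sigma>1)\<^sup>*" if "t \<in> \<Omega>" "h t = h e" for t
    proof
      assume ut: "(u, t) \<in> (induced \<Sigma>1)\<^sup>*"
      have "t = e" using that e inj_h by (auto simp: inj_on_def)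
      with ut u have "(u, e) \<in> (induced \<Sigma>1)\<^sup>*" "u \<noteq> e" by auto
      then obtain v where v: "(u, v) \<in> induced \<Sigma>1" "(v, e) \<in> (induced \<Sigma>1)\<^sup>*"
        by (metis converse_rtranclE)
      have "v = s" using v(1) u unfolding ind1 by (auto simp: induced_def)
      have "(s, x) \<in> (induced \<Sigma>1)\<^sup>* \<Longrightarrow> (s, x) \<in> (induced \<Sigma>)\<^sup>* \<and> x \<noteq> u" for x
      proof (induction rule: rtrancl_induct)
        case (step y z)
        moreover have "u \<notin> Range (induced \<Sigma>)" using u Range_induced by blast
        ultimately show ?case using u unfolding ind1 by (auto intro: rtrancl_into_rtrancl)
      qed (use u in auto)
      then show False using v \<open>v = s\<close> se by blast
    qed
  qed (use u e hW in \<open>auto simp: \<Sigma>1_def\<close>)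
  have "(e, u) \<in> induced \<Sigma>2" "(u, s) \<in> induced \<Sigma>2"
    using u e by (auto simp: induced_def \<Sigma>2_def \<Sigma>1_def)
  then have "(e, s) \<in> (induced \<Sigma>2)\<^sup>*" by (meson converse_rtrancl_into_rtrancl r_into_rtrancl)
  moreover have "\<Sigma> \<subseteq> \<Sigma>2" by (auto simp: \<Sigma>1_def \<Sigma>2_def)
  ultimately show ?thesis using adm2 by blast
qed

lemma induced_mono: "\<Sigma> \<subseteq> \<Sigma>' \<Longrightarrow> induced \<Sigma> \<subseteq> induced \<Sigma>'"
  by (auto simp: induced_def)

lemma join_induced_half:
  assumes adm: "admissible \<Sigma>" and x: "x \<in> \<Omega> - A" and y: "y \<in> \<Omega> - A"
    and s: "(s, y) \<in> (induced \<Sigma>)\<^sup>*" "s \<notin> Range \<Sigma>"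
  shows "\<exists>\<Sigma>'. \<Sigma> \<subseteq> \<Sigma>' \<and> admissible \<Sigma>' \<and> joined (induced \<Sigma>') x y"
proof -
  note D = admissibleD[OF adm]
  obtain e where e: "(x, e) \<in> (induced \<Sigma>)\<^sup>*" "e \<notin> Domain (induced \<Sigma>)"
    using D(10) x by (auto simp: terminates_on_def)
  have "e \<in> \<Omega>" "s \<in> \<Omega>" using path_in_\<Omega>(1)[OF adm] e(1) s(1) x y by blast+
  show ?thesis
  proof (cases "(s, e) \<in> (induced \<Sigma>)\<^sup>*")
    case True
    then have "joined (induced \<Sigma>) x y"
      using same_path_if_ends_joined[OF single_valued_induced single_valued_induced_converse, OF D(2,3) e s(1)]
      by (simp add: joined_def)
    then show ?thesis using adm by blast
  next
    case False
    have "h e \<notin> Domain \<Sigma>" using e(2) \<open>e \<in> \<Omega>\<close> by (simp add: Domain_induced)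
    then obtain \<Sigma>' where S: "\<Sigma> \<subseteq> \<Sigma>'" "admissible \<Sigma>'" "(e, s) \<in> (induced \<Sigma>')\<^sup>*"
      using join_induced_ends[OF adm \<open>e \<in> \<Omega>\<close> _ \<open>s \<in> \<Omega>\<close> s(2) False] by blast
    have "(induced \<Sigma>)\<^sup>* \<subseteq> (induced \<Sigma>')\<^sup>*" by (intro rtrancl_mono induced_mono S)
    then have "(x, e) \<in> (induced \<Sigma>')\<^sup>*" "(s, y) \<in> (induced \<Sigma>')\<^sup>*" using e s by auto
    then have "(x, y) \<in> (induced \<Sigma>')\<^sup>*" using S(3) by (meson rtrancl_trans)
    then show ?thesis using S by (auto simp: joined_def)
  qed
qed

text \<open>
  Two paths can be joined in either order, provided that the start of the later one can still receive
  an edge. A start that cannot is the image of a point in \<open>W - h ` \<Omega>\<close>; there is only one such start, so if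
  neither order works, then both starts coincide.
\<close>
lemma extend_joined_induced:
  assumes adm: "admissible \<Sigma>" and x: "x \<in> \<Omega> - A" and y: "y \<in> \<Omega> - A"
  shows "\<exists>\<Sigma>'. \<Sigma> \<subseteq> \<Sigma>' \<and> admissible \<Sigma>' \<and> joined (induced \<Sigma>') x y"
proof -
  note D = admissibleD[OF adm]
  have start: "\<exists>s. s \<in> \<Omega> - A \<and> (s, v) \<in> (induced \<Sigma>)\<^sup>* \<and> s \<notin> Range (induced \<Sigma>)"
    if v: "v \<in> \<Omega> - A" for v
  proof -
    obtain s where "(v, s) \<in> ((induced \<Sigma>)\<inverse>)\<^sup>*" "s \<notin> Domain ((induced \<Sigma>)\<inverse>)"
      by (rule terminates_onE[OF D(11) v])
    then have "(s, v) \<in> (induced \<Sigma>)\<^sup>*" "s \<notin> Range (induced \<Sigma>)"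
      by (simp_all add: rtrancl_converse)
    then show ?thesis using path_in_\<Omega>(1)[OF adm, of s v] path_outside_A[OF adm, of s v] v by blast
  qed
  obtain s where s: "s \<in> \<Omega> - A" "(s, x) \<in> (induced \<Sigma>)\<^sup>*" "s \<notin> Range (induced \<Sigma>)"
    using start[OF x] by blast
  obtain t where t: "t \<in> \<Omega> - A" "(t, y) \<in> (induced \<Sigma>)\<^sup>*" "t \<notin> Range (induced \<Sigma>)"
    using start[OF y] by blast
  consider "t \<notin> Range \<Sigma>" | "s \<notin> Range \<Sigma>" | "s \<in> Range \<Sigma>" "t \<in> Range \<Sigma>" by blast
  then show ?thesis
  proof cases
    case 1
    then show ?thesis using join_induced_half[OF adm x y t(2)] by blast
  next
    case 2
    then show ?thesis using join_induced_half[OF adm y x s(2)] joined_sym by metis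
  next
    case 3
    have *: "w \<in> W - h ` \<Omega> - \<Sigma>\<inverse> `` A"
      if "(w, v) \<in> \<Sigma>" "v \<in> \<Omega> - A" "v \<notin> Range (induced \<Sigma>)" for w v
    proof -
      have "w \<notin> \<Sigma>\<inverse> `` A" using that D(2) by (auto dest: single_valuedD)
      then show ?thesis using that D(1) by (auto simp: induced_def)
    qed
    from 3 obtain w w' where w: "(w, s) \<in> \<Sigma>" "(w', t) \<in> \<Sigma>" by auto
    then have "w = w'" using D(15)[of w w'] * s t by blast
    then have "s = t" using w D(2) by (auto dest: single_valuedD)
    then have "joined (induced \<Sigma>) x y"
      using rtrancl_comparable[OF single_valued_induced[OF D(2)]] s t by (auto simp: joined_def)
    then show ?thesis using adm by blast
  qed
qed

text \<open>
  The mirror image of the previous construction: the path from \<open>e\<close> to \<open>s\<close> in the second factor passes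
  through \<open>h u\<close>. Now the first factor acquires edges from \<open>u\<close> to \<open>e\<close> and, if \<open>s = h t\<close>, from \<open>t\<close> to \<open>h u\<close>;
  the first is harmless as \<open>u\<close> is isolated, the second as no edge leaves \<open>h u\<close>.
\<close>
lemma join_ends:
  assumes adm: "admissible \<Sigma>"
    and e: "e \<in> \<Omega>" "e \<notin> Range \<Sigma>" and s: "s \<in> W" "s \<notin> Domain \<Sigma>"
    and se: "(s, e) \<notin> (\<Sigma>\<inverse>)\<^sup>*"
  shows "\<exists>\<Sigma>'. \<Sigma> \<subseteq> \<Sigma>' \<and> admissible \<Sigma>' \<and> (e, s) \<in> (\<Sigma>'\<inverse>)\<^sup>*"
proof -
  obtain u where uF: "u \<in> fresh \<Sigma>" "u \<notin> {e, s}" "h u \<notin> {e, s}" "h (h u) \<notin> {e, s}"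
    by (rule obtain_fresh[OF adm, of "{e, s}"]) auto
  note u = uF(2-) freshD[OF uF(1)]
  have hhu: "h (h u) \<noteq> h u" using inj_onD[OF inj_h, of "h u" u] u by blast
  define \<Sigma>1 where "\<Sigma>1 = insert (h u, e) \<Sigma>"
  have adm1: "admissible \<Sigma>1"
    unfolding \<Sigma>1_def
  proof (rule admissible_insert[OF adm])
    show "(h u, e) \<notin> (\<Sigma>\<inverse>)\<^sup>*" using rtrancl_not_Domain[of "h u" e "\<Sigma>\<inverse>"] u by auto
    show "(e, t) \<notin> (induced \<Sigma>)\<^sup>*" if "t \<in> \<Omega>" "h t = h u" for t
    proof -
      have "t = u" using that u inj_h by (auto simp: inj_on_def)
      then show ?thesis using rtrancl_not_Range[of e u "induced \<Sigma>"] u Range_induced by blast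
    qed
  qed (use u e in auto)
  define \<Sigma>2 where "\<Sigma>2 = insert (s, h u) \<Sigma>1"
  have adm2: "admissible \<Sigma>2"
    unfolding \<Sigma>2_def
  proof (rule admissible_insert[OF adm1])
    show "(s, h u) \<notin> (\<Sigma>1\<inverse>)\<^sup>*"
    proof
      assume "(s, h u) \<in> (\<Sigma>1\<inverse>)\<^sup>*"
      moreover have "s \<noteq> h u" using u by auto
      ultimately obtain v where v: "(s, v) \<in> (\<Sigma>1\<inverse>)\<^sup>*" "(v, h u) \<in> \<Sigma>1\<inverse>"
        by (metis rtranclE)
      have "v = e" using v(2) u by (auto simp: \<Sigma>1_def)
      have "(s, x) \<in> (\<Sigma>1\<inverse>)\<^sup>* \<Longrightarrow> x = h u \<or> (s, x) \<in> (\<Sigma>\<inverse>)\<^sup>*" for x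
      proof (induction rule: rtrancl_induct)
        case (step y z)
        then show ?case using u by (auto simp: \<Sigma>1_def intro: rtrancl_into_rtrancl)
      qed auto
      then show False using v \<open>v = e\<close> se u by blast
    qed
    show "(h u, t) \<notin> (induced \<Sigma>1)\<^sup>*" if "t \<in> \<Omega>" "h t = s" for t
      using rtrancl_not_Domain[of "h u" t "induced \<Sigma>1"] u that hhu
      by (auto simp: Domain_induced \<Sigma>1_def)
  qed (use u s in \<open>auto simp: \<Sigma>1_def\<close>)
  have "(e, h u) \<in> \<Sigma>2\<inverse>" "(h u, s) \<in> \<Sigma>2\<inverse>"
    by (auto simp: \<Sigma>2_def \<Sigma>1_def)
  then have "(e, s) \<in> (\<Sigma>2\<inverse>)\<^sup>*" by (meson converse_rtrancl_into_rtrancl r_into_rtrancl)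
  moreover have "\<Sigma> \<subseteq> \<Sigma>2" by (auto simp: \<Sigma>1_def \<Sigma>2_def)
  ultimately show ?thesis using adm2 by blast
qed

lemma join_half:
  assumes adm: "admissible \<Sigma>" and x: "x \<in> \<Omega> - B" and y: "y \<in> \<Omega> - B"
    and s: "(s, y) \<in> (\<Sigma>\<inverse>)\<^sup>*" "s \<notin> Domain \<Sigma>" "s \<in> W"
  shows "\<exists>\<Sigma>'. \<Sigma> \<subseteq> \<Sigma>' \<and> admissible \<Sigma>' \<and> joined (\<Sigma>'\<inverse>) x y"
proof -
  note D = admissibleD[OF adm]
  obtain e where e: "(x, e) \<in> (\<Sigma>\<inverse>)\<^sup>*" "e \<notin> Domain (\<Sigma>\<inverse>)"
    using D(12) x by (auto simp: terminates_on_def)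
  have "e \<in> \<Omega>" using path_in_\<Omega>(2)[OF adm] e(1) x by blast
  show ?thesis
  proof (cases "(s, e) \<in> (\<Sigma>\<inverse>)\<^sup>*")
    case True
    then have "joined (\<Sigma>\<inverse>) x y"
      using same_path_if_ends_joined[OF D(3) _ e s(1)] D(2) by (simp add: joined_def)
    then show ?thesis using adm by blast
  next
    case False
    then obtain \<Sigma>' where S: "\<Sigma> \<subseteq> \<Sigma>'" "admissible \<Sigma>'" "(e, s) \<in> (\<Sigma>'\<inverse>)\<^sup>*"
      using join_ends[OF adm \<open>e \<in> \<Omega>\<close> _ s(3,2)] e(2) by auto
    have "(\<Sigma>\<inverse>)\<^sup>* \<subseteq> (\<Sigma>'\<inverse>)\<^sup>*" using S by (intro rtrancl_mono) auto
    then have "(x, e) \<in> (\<Sigma>'\<inverse>)\<^sup>*" "(s, y) \<in> (\<Sigma>'\<inverse>)\<^sup>*" using e s by auto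
    then have "(x, y) \<in> (\<Sigma>'\<inverse>)\<^sup>*" using S(3) by (meson rtrancl_trans)
    then show ?thesis using S by (auto simp: joined_def)
  qed
qed

text \<open>
  Here the starts that cannot receive an edge are the points outside \<open>W\<close>.
\<close>
lemma extend_joined:
  assumes adm: "admissible \<Sigma>" and x: "x \<in> \<Omega> - B" and y: "y \<in> \<Omega> - B"
  shows "\<exists>\<Sigma>'. \<Sigma> \<subseteq> \<Sigma>' \<and> admissible \<Sigma>' \<and> joined (\<Sigma>'\<inverse>) x y"
proof -
  note D = admissibleD[OF adm]
  have start: "\<exists>s. s \<in> \<Omega> - B \<and> (s, v) \<in> (\<Sigma>\<inverse>)\<^sup>* \<and> s \<notin> Domain \<Sigma>" if v: "v \<in> \<Omega> - B" for v
  proof -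
    obtain s where "(v, s) \<in> \<Sigma>\<^sup>*" "s \<notin> Domain \<Sigma>"
      by (rule terminates_onE[OF D(13) v])
    then have "(s, v) \<in> (\<Sigma>\<inverse>)\<^sup>*" "s \<notin> Domain \<Sigma>"
      by (simp_all add: rtrancl_converse)
    then show ?thesis using path_in_\<Omega>(2)[OF adm, of s v] path_outside_B[OF adm, of s v] v by blast
  qed
  obtain s where s: "s \<in> \<Omega> - B" "(s, x) \<in> (\<Sigma>\<inverse>)\<^sup>*" "s \<notin> Domain \<Sigma>"
    using start[OF x] by blast
  obtain t where t: "t \<in> \<Omega> - B" "(t, y) \<in> (\<Sigma>\<inverse>)\<^sup>*" "t \<notin> Domain \<Sigma>"
    using start[OF y] by blast
  consider "t \<in> W" | "s \<in> W" | "s \<notin> W" "t \<notin> W" by blast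
  then show ?thesis
  proof cases
    case 1
    then show ?thesis using join_half[OF adm x y t(2,3)] by blast
  next
    case 2
    then show ?thesis using join_half[OF adm y x s(2,3)] joined_sym by metis
  next
    case 3
    then have "s = t" using free_start s t by blast
    then have "joined (\<Sigma>\<inverse>) x y"
      using rtrancl_comparable[OF D(3)] s t by (auto simp: joined_def)
    then show ?thesis using adm by blast
  qed
qed

text \<open>
  Along a sequence that meets the requirements of the preceding lemmas for all points and all pairs of
  points, the union is the graph of a bijection for which both remaining parts are connected.
\<close>
theorem complete_linking:
  assumes adm: "admissible \<Sigma>0"
  obtains \<sigma> where "bij_betw \<sigma> W \<Omega>" "\<And>w u. (w, u) \<in> \<Sigma>0 \<Longrightarrow> \<sigma> w = u"
    "infinite_orbit (\<Omega> - A) (\<lambda>z. \<sigma> (h z))" "infinite_orbit (\<Omega> - B) (inv_into W \<sigma>)"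
proof -
  define Q where "Q = (\<lambda>w \<Sigma>. w \<in> Domain \<Sigma>) ` W \<union> (\<lambda>z \<Sigma>. z \<in> Range \<Sigma>) ` \<Omega> \<union>
    (\<lambda>(x, y) \<Sigma>. joined (induced \<Sigma>) x y) ` ((\<Omega> - A) \<times> (\<Omega> - A)) \<union>
    (\<lambda>(x, y) \<Sigma>. joined (\<Sigma>\<inverse>) x y) ` ((\<Omega> - B) \<times> (\<Omega> - B))"
  have "countable W" using W countable countable_subset by blast
  then have "countable Q" unfolding Q_def
    by (intro countable_Un countable_image countable_SIGMA countable_Diff countable)
  have "\<exists>Y. \<Sigma> \<subseteq> Y \<and> admissible Y \<and> q Y" if S: "admissible \<Sigma>" and q: "q \<in> Q" for \<Sigma> q
  proof -
    from q consider w where "w \<in> W" "q = (\<lambda>\<Sigma>. w \<in> Domain \<Sigma>)"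
      | z where "z \<in> \<Omega>" "q = (\<lambda>\<Sigma>. z \<in> Range \<Sigma>)"
      | x y where "x \<in> \<Omega> - A" "y \<in> \<Omega> - A" "q = (\<lambda>\<Sigma>. joined (induced \<Sigma>) x y)"
      | x y where "x \<in> \<Omega> - B" "y \<in> \<Omega> - B" "q = (\<lambda>\<Sigma>. joined (\<Sigma>\<inverse>) x y)"
      unfolding Q_def by (elim UnE imageE SigmaE) simp_all
    then show ?thesis
    proof cases
      case 1 then show ?thesis using extend_Domain[OF S] by simp
    next
      case 2 then show ?thesis using extend_Range[OF S] by simp
    next
      case 3 then show ?thesis using extend_joined_induced[OF S] by simp
    next
      case 4 then show ?thesis using extend_joined[OF S] by simp
    qed
  qed
  from fulfil_requirements[of Q admissible \<Sigma>0, OF \<open>countable Q\<close> adm this]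
  obtain X where X0: "X 0 = \<Sigma>0" and X: "\<And>n::nat. admissible (X n)"
    and inc: "\<And>n. X n \<subseteq> X (Suc n)" and meets: "\<And>q. q \<in> Q \<Longrightarrow> \<exists>n. q (X n)"
    by auto
  note D = admissibleD[OF X]
  have le: "X m \<subseteq> X n" if "m \<le> n" for m n
    using lift_Suc_mono_le[of X, OF inc that] .
  have dom: "\<exists>n. w \<in> Domain (X n)" if "w \<in> W" for w
    using meets[of "\<lambda>\<Sigma>. w \<in> Domain \<Sigma>"] that by (auto simp: Q_def)
  have ran: "\<exists>n. z \<in> Range (X n)" if "z \<in> \<Omega>" for z
    using meets[of "\<lambda>\<Sigma>. z \<in> Range \<Sigma>"] that by (auto simp: Q_def)
  have joinA: "\<exists>n. joined (induced (X n)) x y" if "x \<in> \<Omega> - A" "y \<in> \<Omega> - A" for x y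
  proof (rule meets)
    have "(\<lambda>\<Sigma>. joined (induced \<Sigma>) x y) = (\<lambda>(x, y) \<Sigma>. joined (induced \<Sigma>) x y) (x, y)" by simp
    then show "(\<lambda>\<Sigma>. joined (induced \<Sigma>) x y) \<in> Q" using that unfolding Q_def by blast
  qed
  have joinB: "\<exists>n. joined ((X n)\<inverse>) x y" if "x \<in> \<Omega> - B" "y \<in> \<Omega> - B" for x y
  proof (rule meets)
    have "(\<lambda>\<Sigma>. joined (\<Sigma>\<inverse>) x y) = (\<lambda>(x, y) \<Sigma>. joined (\<Sigma>\<inverse>) x y) (x, y)" by simp
    then show "(\<lambda>\<Sigma>. joined (\<Sigma>\<inverse>) x y) \<in> Q" using that unfolding Q_def by blast
  qed
  define S where "S = (\<Union>n. X n)"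
  have common: "\<exists>n. p \<in> X n \<and> q \<in> X n" if "p \<in> S" "q \<in> S" for p q
  proof -
    obtain m n where "p \<in> X m" "q \<in> X n" using \<open>p \<in> S\<close> \<open>q \<in> S\<close> unfolding S_def by blast
    then have "p \<in> X (max m n)" "q \<in> X (max m n)"
      using le[of m "max m n"] le[of n "max m n"] by auto
    then show ?thesis by blast
  qed
  have S1: "u = u'" if "(w, u) \<in> S" "(w, u') \<in> S" for w u u'
    using common[OF that] D(2) by (metis single_valuedD)
  have S2: "w = w'" if "(w, u) \<in> S" "(w', u) \<in> S" for w w' u
    using common[OF that] D(3) by (metis single_valuedD converseI)
  have SW: "w \<in> W" "u \<in> \<Omega>" if "(w, u) \<in> S" for w u
    using that D(1) unfolding S_def by blast+
  define \<sigma> where "\<sigma> w = (THE u. (w, u) \<in> S)" for w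
  have S\<sigma>: "\<sigma> w = u" if "(w, u) \<in> S" for w u
    unfolding \<sigma>_def using S1 that by (intro the_equality)
  have \<sigma>S: "(w, \<sigma> w) \<in> S" if "w \<in> W" for w
    using dom[OF that] S\<sigma> unfolding S_def by blast
  have bij: "bij_betw \<sigma> W \<Omega>"
  proof (rule bij_betw_imageI)
    show "inj_on \<sigma> W" using \<sigma>S S2 by (metis inj_onI)
    show "\<sigma> ` W = \<Omega>"
    proof (intro equalityI subsetI)
      fix z assume "z \<in> \<Omega>"
      then obtain w where "(w, z) \<in> S" using ran unfolding S_def by blast
      then show "z \<in> \<sigma> ` W" using S\<sigma> SW by blast
    next
      fix z assume "z \<in> \<sigma> ` W"
      then show "z \<in> \<Omega>" using \<sigma>S SW by blast
    qed
  qed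
  have ne: "\<Omega> - A \<noteq> {}" "\<Omega> - B \<noteq> {}"
  proof -
    obtain u where "u \<in> fresh \<Sigma>0" using obtain_fresh[OF adm, of "{}"] by auto
    then show "\<Omega> - A \<noteq> {}" "\<Omega> - B \<noteq> {}"
      using freshD[of u \<Sigma>0] admissibleD(4,7)[OF adm] by auto
  qed
  have "infinite_orbit (\<Omega> - A) (\<lambda>z. \<sigma> (h z))"
  proof (rule infinite_orbit_limit[where R = "\<lambda>n. induced (X n)"])
    show gr: "\<exists>n. (z, \<sigma> (h z)) \<in> induced (X n)" if "z \<in> \<Omega> - A" for z
      using \<sigma>S[of "h z"] that hW unfolding S_def induced_def by auto
    show "(\<lambda>z. \<sigma> (h z)) \<in> \<Omega> - A \<rightarrow> \<Omega> - A"
    proof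
      fix z assume z: "z \<in> \<Omega> - A"
      then obtain n where "(z, \<sigma> (h z)) \<in> induced (X n)" using gr by blast
      then show "\<sigma> (h z) \<in> \<Omega> - A" using D(6)[of z _ n] D(1)[of n] z by (auto simp: induced_def)
    qed
    show "inj_on (\<lambda>z. \<sigma> (h z)) (\<Omega> - A)"
    proof (rule inj_onI)
      fix x y assume xy: "x \<in> \<Omega> - A" "y \<in> \<Omega> - A" "\<sigma> (h x) = \<sigma> (h y)"
      then have "h x \<in> W" "h y \<in> W" using hW by auto
      then have "h x = h y" using xy(3) bij by (auto simp: bij_betw_def dest: inj_onD)
      then show "x = y" using xy inj_onD[OF inj_h, of x y] by simp
    qed
  qed (fact ne D(10) joinA single_valued_induced[OF D(2)] induced_mono[OF inc])+
  moreover have "infinite_orbit (\<Omega> - B) (inv_into W \<sigma>)"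
  proof (rule infinite_orbit_limit[where R = "\<lambda>n. (X n)\<inverse>"])
    have inv: "(inv_into W \<sigma> z, z) \<in> S" if "z \<in> \<Omega>" for z
      using \<sigma>S[of "inv_into W \<sigma> z"] that bij
      by (metis bij_betw_imp_surj_on f_inv_into_f inv_into_into)
    show gr: "\<exists>n. (z, inv_into W \<sigma> z) \<in> (X n)\<inverse>" if "z \<in> \<Omega> - B" for z
      using inv[of z] that unfolding S_def by auto
    show "inv_into W \<sigma> \<in> \<Omega> - B \<rightarrow> \<Omega> - B"
    proof
      fix z assume z: "z \<in> \<Omega> - B"
      then obtain n where "(z, inv_into W \<sigma> z) \<in> (X n)\<inverse>" using gr by blast
      then show "inv_into W \<sigma> z \<in> \<Omega> - B" using D(9)[of _ z n] D(1)[of n] W z by auto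
    qed
    show "inj_on (inv_into W \<sigma>) (\<Omega> - B)"
      using bij by (metis Diff_subset bij_betw_imp_surj_on inj_on_inv_into)
  next
    show "(X n)\<inverse> \<subseteq> (X (Suc n))\<inverse>" for n using inc[of n] by auto
  qed (fact ne D(3,12) joinB)+
  moreover have "\<sigma> w = u" if "(w, u) \<in> \<Sigma>0" for w u
    using S\<sigma> that X0 unfolding S_def by blast
  ultimately show ?thesis using that[of \<sigma>] bij by blast
qed

end

section \<open>The initial relation and the factorization\<close>

lemma single_valued_Un_disjoint:
  assumes "single_valued R" "single_valued S" "Domain R \<inter> Domain S = {}"
  shows "single_valued (R \<union> S)"
  using assms by (auto simp: single_valued_def)

lemma single_valued_image_pair:
  assumes "inj_on a X" shows "single_valued ((\<lambda>x. (a x, b x)) ` X)"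
  using assms by (auto simp: single_valued_def inj_on_def)

lemma inj_on_compose:
  assumes v: "inj_on v X" and u: "inj_on u Y" and vX: "\<And>x. x \<in> X \<Longrightarrow> v x \<in> Y"
  shows "inj_on (\<lambda>x. u (v x)) X"
proof (rule inj_onI)
  fix x y assume "x \<in> X" "y \<in> X" "u (v x) = u (v y)"
  then show "x = y" using inj_onD[OF u, of "v x" "v y"] inj_onD[OF v, of x y] vX by blast
qed

lemma inj_on_eq: "inj_on h X \<Longrightarrow> x \<in> X \<Longrightarrow> y \<in> X \<Longrightarrow> h x = h y \<longleftrightarrow> x = y"
  by (auto simp: inj_on_def)

text \<open>
  Within \<open>h ` h ` support \<Omega> h\<close> every point is related by \<open>h\<close> or \<open>h \<circ> h\<close> to finitely many others only, so an
  infinite homogeneous set for this relation, given by Ramsey's theorem, consists of unrelated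
  points. Lying in the image of \<open>h \<circ> h\<close> keeps the set away from the points outside the image of \<open>h\<close> and
  from their images.
\<close>
lemma exists_sparse_set:
  assumes h: "h \<in> Inj \<Omega>" and inf: "infinite (support \<Omega> h)"
  shows "\<exists>S. S \<subseteq> h ` h ` \<Omega> \<and> infinite S \<and> (\<forall>x\<in>S. \<forall>y\<in>S. h x \<noteq> y \<and> (x \<noteq> y \<longrightarrow> h (h x) \<noteq> y))"
proof -
  have hO: "h ` \<Omega> \<subseteq> \<Omega>" and inj: "inj_on h \<Omega>" using h by (auto simp: Inj_def)
  define T where "T = h ` h ` support \<Omega> h"
  have s\<Omega>: "support \<Omega> h \<subseteq> \<Omega>" by (auto simp: support_def)
  then have hs\<Omega>: "h ` support \<Omega> h \<subseteq> \<Omega>" using hO by auto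
  have "infinite T"
    unfolding T_def using inf inj s\<Omega> hs\<Omega> by (metis finite_imageD inj_on_subset)
  have T\<Omega>: "T \<subseteq> \<Omega>" using hs\<Omega> hO unfolding T_def by auto
  have moved: "h x \<noteq> x" if "x \<in> T" for x
    using that s\<Omega> hO unfolding T_def
    by (auto simp: inj_on_eq[OF inj] image_subset_iff support_def)
  define close where "close x y \<longleftrightarrow> h x = y \<or> h y = x \<or> h (h x) = y \<or> h (h y) = x" for x y
  define c where "c P = (if \<exists>x y. P = {x, y} \<and> close x y then 1 else (0::nat))" for P
  have c: "c {x, y} = (if close x y then 1 else 0)" for x y
    unfolding c_def by (auto simp: doubleton_eq_iff close_def)
  obtain S t where S: "S \<subseteq> T" "infinite S" and t: "\<And>x y. x \<in> S \<Longrightarrow> y \<in> S \<Longrightarrow> x \<noteq> y \<Longrightarrow> c {x, y} = t"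
  proof -
    have "\<forall>x\<in>T. \<forall>y\<in>T. x \<noteq> y \<longrightarrow> c {x, y} < 2" by (simp add: c_def)
    from Ramsey2[OF \<open>infinite T\<close> this] show ?thesis by (elim exE conjE) (rule that, auto)
  qed
  have "\<not> close x y" if "x \<in> S" "y \<in> S" "x \<noteq> y" for x y
  proof
    assume "close x y"
    then have "t = 1" using t[OF that] c by auto
    have "S - {x} \<subseteq> {h x, h (h x)} \<union> {y\<in>\<Omega>. h y \<in> {x}} \<union> {y\<in>\<Omega>. h y \<in> {y\<in>\<Omega>. h y \<in> {x}}}"
    proof
      fix y assume y: "y \<in> S - {x}"
      then have "c {x, y} = 1" using t[of x y] \<open>x \<in> S\<close> \<open>t = 1\<close> by auto
      then have "close x y" by (simp add: c split: if_splits)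
      moreover have "y \<in> \<Omega>" "h y \<in> \<Omega>" using y S(1) T\<Omega> hO by auto
      ultimately show "y \<in> {h x, h (h x)} \<union> {y\<in>\<Omega>. h y \<in> {x}} \<union> {y\<in>\<Omega>. h y \<in> {y\<in>\<Omega>. h y \<in> {x}}}"
        by (auto simp: close_def)
    qed
    moreover have fin: "finite {y\<in>\<Omega>. h y \<in> F}" if "finite F" for F
      using finite_vimage_IntI[OF that inj] by (rule finite_subset[rotated]) auto
    have "finite ({h x, h (h x)} \<union> {y\<in>\<Omega>. h y \<in> {x}} \<union> {y\<in>\<Omega>. h y \<in> {y\<in>\<Omega>. h y \<in> {x}}})"
      by (intro finite_UnI fin) auto
    ultimately show False using S(2) by (meson finite.emptyI finite_Diff2 finite_insert finite_subset)
  qed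
  moreover have "h x \<noteq> x" if "x \<in> S" for x using moved that S(1) by auto
  moreover have "S \<subseteq> h ` h ` \<Omega>"
    using S(1) image_mono[OF image_mono[OF s\<Omega>, of h], of h] unfolding T_def by (rule subset_trans)
  ultimately show ?thesis using S(2) unfolding close_def by (intro exI[of _ S]) metis
qed

lemma countable_inj_into_infinite:
  assumes "countable X" "infinite Y"
  shows "\<exists>\<alpha>. inj_on \<alpha> X \<and> \<alpha> ` X \<subseteq> Y"
proof -
  obtain e :: "nat \<Rightarrow> 'b" where e: "inj e" "range e \<subseteq> Y"
    using infinite_countable_subset[OF assms(2)] by blast
  have "inj_on (e \<circ> to_nat_on X) X"
    using inj_on_to_nat_on[OF assms(1)] e(1) by (meson comp_inj_on inj_on_subset subset_UNIV)
  then show ?thesis using e(2) by (intro exI[of _ "e \<circ> to_nat_on X"]) auto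
qed

text \<open>
  The bijection \<open>k\<close> splits \<open>\<Omega> - h ` \<Omega>\<close> into points \<open>p m\<close> and \<open>q m\<close>. With \<open>W\<close> the complement of the latter,
  any bijection \<open>\<sigma> : W \<rightarrow> \<Omega>\<close> factors \<open>h\<close> as \<open>\<sigma>\<^sup>-\<^sup>1\<close> after \<open>\<sigma> \<circ> h\<close>; the first factor misses the points \<open>\<sigma> (p m)\<close>
  and the second one the points \<open>q m\<close>. The complement of \<open>C\<close> is copied to a set \<open>A\<close> by \<open>\<alpha>\<close>, that of \<open>D\<close> to \<open>B\<close>
  by \<open>\<beta>\<close>, and \<open>\<Sigma>0\<close> collects what this prescribes for \<open>\<sigma>\<close>. Since the copies are placed on a sparse set,
  the prescription for one factor only gives isolated edges of the other.
\<close>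
lemma factorization_exists:
  assumes \<Omega>: "countable \<Omega>" and f: "f \<in> Inj \<Omega>" and g: "g \<in> Inj \<Omega>" and h: "h \<in> Inj \<Omega>"
    and supp: "infinite (support \<Omega> h)"
    and Cf: "cycle_under \<Omega> f C" "infinite C" and Cg: "cycle_under \<Omega> g D" "infinite D"
    and k: "bij_betw k ((\<Omega> - f ` \<Omega>) <+> (\<Omega> - g ` \<Omega>)) (\<Omega> - h ` \<Omega>)"
  shows "\<exists>\<theta> \<eta>. \<theta> permutes \<Omega> \<and> \<eta> permutes \<Omega> \<and>
    (\<forall>z\<in>\<Omega>. h z = \<eta> (g (inv \<eta> (\<theta> (f (inv \<theta> z))))))"
proof -
  have f\<Omega>: "f x \<in> \<Omega>" and g\<Omega>: "g x \<in> \<Omega>" and h\<Omega>: "h x \<in> \<Omega>" if "x \<in> \<Omega>" for x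
    using f g h that by (auto simp: Inj_def)
  have inj: "inj_on f \<Omega>" "inj_on g \<Omega>" "inj_on h \<Omega>" using f g h by (auto simp: Inj_def)
  have C_inv: "f x \<in> C \<longleftrightarrow> x \<in> C" if "x \<in> \<Omega>" for x
    using Cf that unfolding cycle_under_def invariant_under_def by blast
  have D_inv: "g x \<in> D \<longleftrightarrow> x \<in> D" if "x \<in> \<Omega>" for x
    using Cg that unfolding cycle_under_def invariant_under_def by blast
  have orb_f: "infinite_orbit C f" by (rule infinite_cycle_orbit[OF f Cf])
  have orb_g: "infinite_orbit D g" by (rule infinite_cycle_orbit[OF g Cg])
  have C\<Omega>: "C \<subseteq> \<Omega>" and D\<Omega>: "D \<subseteq> \<Omega>" using Cf Cg unfolding cycle_under_def by blast+
  define p q where "p m = k (Inl m)" and "q m = k (Inr m)" for m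
  have kinj: "inj_on k ((\<Omega> - f ` \<Omega>) <+> (\<Omega> - g ` \<Omega>))"
    and kim: "k ` ((\<Omega> - f ` \<Omega>) <+> (\<Omega> - g ` \<Omega>)) = \<Omega> - h ` \<Omega>"
    using k by (auto simp: bij_betw_def)
  have p: "inj_on p (\<Omega> - f ` \<Omega>)" and q: "inj_on q (\<Omega> - g ` \<Omega>)"
    using kinj by (auto simp: p_def q_def inj_on_def)
  have pq: "p m \<noteq> q n" if "m \<in> \<Omega> - f ` \<Omega>" "n \<in> \<Omega> - g ` \<Omega>" for m n
    using kinj that by (auto simp: p_def q_def inj_on_def)
  have pq_im: "p ` (\<Omega> - f ` \<Omega>) \<union> q ` (\<Omega> - g ` \<Omega>) = \<Omega> - h ` \<Omega>"
    unfolding kim[symmetric] by (auto simp: p_def q_def Plus_def)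
  obtain S where S: "S \<subseteq> h ` h ` \<Omega>" "infinite S"
    and S_sparse: "\<And>x y. x \<in> S \<Longrightarrow> y \<in> S \<Longrightarrow> h x \<noteq> y"
      "\<And>x y. x \<in> S \<Longrightarrow> y \<in> S \<Longrightarrow> x \<noteq> y \<Longrightarrow> h (h x) \<noteq> y"
    using exists_sparse_set[OF h supp] by blast
  obtain S1 S' where S1: "S1 \<subseteq> S" "infinite S1" and S': "S' \<subseteq> S" "infinite S'" "S1 \<inter> S' = {}"
    using infinite_split[OF S(2)] by metis
  obtain S2 S3 where S2: "S2 \<subseteq> S'" "infinite S2" and S3: "S3 \<subseteq> S'" "infinite S3" "S2 \<inter> S3 = {}"
    using infinite_split[OF S'(2)] by metis
  have "countable (\<Omega> - C)" "countable (\<Omega> - D)" using \<Omega> by auto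
  then obtain \<alpha> \<gamma> where \<alpha>: "inj_on \<alpha> (\<Omega> - C)" "\<alpha> ` (\<Omega> - C) \<subseteq> S1"
    and \<gamma>: "inj_on \<gamma> (\<Omega> - D)" "\<gamma> ` (\<Omega> - D) \<subseteq> S2"
    using countable_inj_into_infinite[OF _ S1(2)] countable_inj_into_infinite[OF _ S2(2)] by metis
  \<comment> \<open>A point without \<open>g\<close>-predecessor must go to one without predecessor under \<open>\<sigma>\<^sup>-\<^sup>1\<close>, that is, outside \<open>W\<close>.\<close>
  define \<beta> where "\<beta> y = (if y \<in> g ` \<Omega> then \<gamma> y else q y)" for y
  define A B W where "A = \<alpha> ` (\<Omega> - C)" and "B = \<beta> ` (\<Omega> - D)" and "W = \<Omega> - q ` (\<Omega> - g ` \<Omega>)"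
  have S_h: "x \<in> h ` \<Omega>" "x \<in> \<Omega>" if "x \<in> S" for x using that S(1) h\<Omega> by auto
  have S_sub: "S \<subseteq> h ` \<Omega>" using S_h by blast
  have AS: "A \<subseteq> S1" "A \<subseteq> S" using \<alpha> S1 by (auto simp: A_def)
  have B_cases: "x \<in> S2 \<and> x \<in> S \<or> x \<in> q ` (\<Omega> - g ` \<Omega>) \<and> x \<in> \<Omega> \<and> x \<notin> h ` \<Omega>" if "x \<in> B" for x
    using that \<gamma> S2 S' pq_im by (auto simp: B_def \<beta>_def)
  have \<beta>g: "\<beta> (g y) = \<gamma> (g y)" "\<beta> (g y) \<in> S2" "\<beta> (g y) \<in> S" if "y \<in> \<Omega> - D" for y
  proof -
    have "g y \<in> \<Omega> - D" using that g\<Omega> D_inv by auto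
    then have "\<gamma> (g y) \<in> S2" using \<gamma>(2) by auto
    then show "\<beta> (g y) = \<gamma> (g y)" "\<beta> (g y) \<in> S2" "\<beta> (g y) \<in> S"
      using that S2 S' by (auto simp: \<beta>_def)
  qed
  have \<beta>: "inj_on \<beta> (\<Omega> - D)"
  proof (rule inj_onI)
    fix x y assume xy: "x \<in> \<Omega> - D" "y \<in> \<Omega> - D" "\<beta> x = \<beta> y"
    have *: "\<gamma> x \<noteq> q y" if "x \<in> \<Omega> - D" "y \<in> \<Omega> - g ` \<Omega>" for x y
    proof -
      have "\<gamma> x \<in> h ` \<Omega>" using \<gamma>(2) that S2 S' S_h by blast
      moreover have "q y \<notin> h ` \<Omega>" using pq_im that by blast
      ultimately show ?thesis by auto
    qed
    show "x = y"
      using xy * inj_onD[OF \<gamma>(1), of x y] inj_onD[OF q, of x y]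
      unfolding \<beta>_def by (metis Diff_iff)
  qed
  have q_im: "q ` (\<Omega> - g ` \<Omega>) \<inter> h ` \<Omega> = {}" using pq_im by blast
  have S_W: "x \<in> W" if "x \<in> S" for x using S_h[OF that] q_im unfolding W_def by blast
  have h_W: "h x \<in> W" if "x \<in> \<Omega>" for x using that h\<Omega> pq_im by (auto simp: W_def)
  have p_W: "p x \<in> W" "p x \<notin> h ` \<Omega>" "p x \<in> \<Omega>" if "x \<in> \<Omega> - f ` \<Omega>" for x
    using that pq pq_im by (auto simp: W_def)
  have W_p: "x \<in> p ` (\<Omega> - f ` \<Omega>)" if "x \<in> W - h ` \<Omega>" for x
    using that pq_im by (auto simp: W_def)
  have A\<Omega>: "A \<subseteq> \<Omega>" using AS S_h by auto
  have B\<Omega>: "B \<subseteq> \<Omega>" using B_cases S_h by blast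
  have fC: "f x \<in> \<Omega> - C" if "x \<in> \<Omega> - C" for x using that f\<Omega> C_inv by auto
  have gD: "g x \<in> \<Omega> - D" if "x \<in> \<Omega> - D" for x using that g\<Omega> D_inv by auto
  have start_f: "m \<in> C - f ` C" if "m \<in> \<Omega> - f ` \<Omega>" "m \<in> C" for m using that C\<Omega> by auto
  have start_g: "m \<in> D - g ` D" if "m \<in> \<Omega> - g ` \<Omega>" "m \<in> D" for m using that D\<Omega> by auto

  interpret linking \<Omega> W A B h
  proof
    show "countable \<Omega>" "inj_on h \<Omega>" "A \<subseteq> \<Omega>" "B \<subseteq> \<Omega>" by fact+
    show "h ` \<Omega> \<subseteq> W" using h_W by auto
    show "W \<subseteq> \<Omega>" by (auto simp: W_def)
    have *: "\<exists>m\<in>D - g ` D. z = q m" if z: "z \<in> \<Omega> - W - B" for z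
    proof -
      obtain m where m: "m \<in> \<Omega> - g ` \<Omega>" "z = q m" using z by (auto simp: W_def)
      have "m \<in> D"
      proof (rule ccontr)
        assume "m \<notin> D"
        then have "\<beta> m \<in> B" using m by (auto simp: B_def)
        then show False using m z by (simp add: \<beta>_def)
      qed
      then show ?thesis using m start_g by blast
    qed
    show "z = z'" if "z \<in> \<Omega> - W - B" "z' \<in> \<Omega> - W - B" for z z'
      using *[OF that(1)] *[OF that(2)] infinite_orbit_start_unique[OF orb_g] by blast
  qed

  \<comment> \<open>\<open>E1\<close> copies the edges of \<open>f\<close> and \<open>E3\<close> those of \<open>g\<close>; \<open>E2\<close> makes sure that the copy of a point without
     \<open>f\<close>-predecessor has no predecessor under \<open>\<sigma> \<circ> h\<close>.\<close>
  define E1 E2 E3 where "E1 = (\<lambda>x. (h (\<alpha> x), \<alpha> (f x))) ` (\<Omega> - C)"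
    and "E2 = (\<lambda>m. (p m, \<alpha> m)) ` (\<Omega> - f ` \<Omega> - C)"
    and "E3 = (\<lambda>y. (\<beta> (g y), \<beta> y)) ` (\<Omega> - D)"
  define \<Sigma>0 where "\<Sigma>0 = E1 \<union> E2 \<union> E3"
  have \<alpha>A: "\<alpha> x \<in> A" "\<alpha> x \<in> \<Omega>" "\<alpha> x \<in> S" if "x \<in> \<Omega> - C" for x
    using that A\<Omega> AS by (auto simp: A_def)
  have dom1: "Domain E1 = h ` A" and dom2: "Domain E2 = p ` (\<Omega> - f ` \<Omega> - C)"
    and dom3: "Domain E3 \<subseteq> S2" "Domain E3 \<subseteq> S"
    using \<beta>g by (auto simp: E1_def E2_def E3_def A_def)
  have ran12: "Range E1 \<union> Range E2 = A"
  proof -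
    have "Range E1 \<union> Range E2 = \<alpha> ` (f ` (\<Omega> - C) \<union> (\<Omega> - f ` \<Omega> - C))"
      by (auto simp: E1_def E2_def)
    also have "f ` (\<Omega> - C) \<union> (\<Omega> - f ` \<Omega> - C) = \<Omega> - C" using fC C_inv by auto
    finally show ?thesis by (simp add: A_def)
  qed
  have ran3: "Range E3 = B" by (auto simp: E3_def B_def)
  have AB: "A \<inter> B = {}"
  proof -
    have "x \<notin> B" if "x \<in> A" for x
      using B_cases[of x] subsetD[OF AS(1) that] S_h(1)[OF subsetD[OF AS(2) that]] S2(1) S'(3)
      by blast
    then show ?thesis by blast
  qed
  have hAS: "h ` A \<inter> S = {}" using AS S_sparse(1) by blast
  have hA_h: "h ` A \<subseteq> h ` \<Omega>" using A\<Omega> by auto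
  have pS: "p ` (\<Omega> - f ` \<Omega> - C) \<inter> h ` \<Omega> = {}" using p_W by auto
  have B_W: "B \<inter> W = Domain E3"
  proof (intro equalityI subsetI)
    fix x assume x: "x \<in> B \<inter> W"
    then obtain y where y: "y \<in> \<Omega> - D" "x = \<beta> y" by (auto simp: B_def)
    have "y \<in> g ` \<Omega>" using x y by (auto simp: \<beta>_def W_def)
    then obtain y' where "y' \<in> \<Omega>" "y = g y'" by auto
    then show "x \<in> Domain E3" using y D_inv by (auto simp: E3_def)
  next
    fix x assume x: "x \<in> Domain E3"
    then have "x \<in> B" using gD by (auto simp: E3_def B_def)
    then show "x \<in> B \<inter> W" using x dom3 S_W by auto
  qed
  have disj12: "Domain E1 \<inter> Domain E2 = {}" using dom1 dom2 hA_h pS by blast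
  have disj3: "Domain (E1 \<union> E2) \<inter> Domain E3 = {}"
  proof -
    have "h ` A \<inter> Domain E3 = {}" using hAS dom3(2) by (meson disjoint_iff subsetD)
    moreover have "p ` (\<Omega> - f ` \<Omega> - C) \<inter> Domain E3 = {}"
      using pS S_sub dom3(2) by (meson disjoint_iff subsetD)
    ultimately show ?thesis by (simp only: Domain_Un_eq dom1 dom2 Int_Un_distrib2 Un_empty)
  qed
  have sv: "single_valued \<Sigma>0"
  proof -
    have "inj_on (\<lambda>x. h (\<alpha> x)) (\<Omega> - C)"
      using \<alpha>(1) inj(3) \<alpha>A(2) by (rule inj_on_compose)
    then have "single_valued E1" unfolding E1_def by (rule single_valued_image_pair)
    moreover have "single_valued E2"
      unfolding E2_def
      by (intro single_valued_image_pair inj_on_subset[OF p Diff_subset])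
    moreover have "inj_on (\<lambda>y. \<beta> (g y)) (\<Omega> - D)"
      using inj_on_subset[OF inj(2) Diff_subset] \<beta> gD by (rule inj_on_compose)
    then have "single_valued E3" unfolding E3_def by (rule single_valued_image_pair)
    ultimately show ?thesis
      unfolding \<Sigma>0_def using disj12 disj3 by (intro single_valued_Un_disjoint) auto
  qed
  have svc: "single_valued (\<Sigma>0\<inverse>)"
  proof -
    have E1c: "E1\<inverse> = (\<lambda>x. (\<alpha> (f x), h (\<alpha> x))) ` (\<Omega> - C)" by (auto simp: E1_def)
    have E2c: "E2\<inverse> = (\<lambda>m. (\<alpha> m, p m)) ` (\<Omega> - f ` \<Omega> - C)" by (auto simp: E2_def)
    have E3c: "E3\<inverse> = (\<lambda>y. (\<beta> y, \<beta> (g y))) ` (\<Omega> - D)" by (auto simp: E3_def)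
    have "inj_on (\<lambda>x. \<alpha> (f x)) (\<Omega> - C)"
      using inj_on_subset[OF inj(1) Diff_subset] \<alpha>(1) fC by (rule inj_on_compose)
    then have "single_valued (E1\<inverse>)" unfolding E1c by (rule single_valued_image_pair)
    moreover have "single_valued (E2\<inverse>)"
      unfolding E2c by (intro single_valued_image_pair inj_on_subset[OF \<alpha>(1)]) blast
    moreover have "single_valued (E3\<inverse>)" unfolding E3c using \<beta> by (rule single_valued_image_pair)
    moreover have "Range E1 \<inter> Range E2 = {}"
    proof -
      have "\<alpha> (f x) \<noteq> \<alpha> m" if "x \<in> \<Omega> - C" "m \<in> \<Omega> - f ` \<Omega> - C" for x m
        using inj_onD[OF \<alpha>(1), of "f x" m] fC[OF that(1)] that by blast
      then show ?thesis by (auto simp: E1_def E2_def)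
    qed
    moreover have "Range (E1 \<union> E2) \<inter> Range E3 = {}" using ran12 ran3 AB by (simp add: Range_Un_eq)
    ultimately show ?thesis
      unfolding \<Sigma>0_def converse_Un by (intro single_valued_Un_disjoint) auto
  qed
  have Dom: "Domain \<Sigma>0 = h ` A \<union> p ` (\<Omega> - f ` \<Omega> - C) \<union> Domain E3"
    by (simp only: \<Sigma>0_def Domain_Un_eq dom1 dom2)
  have Ran: "Range \<Sigma>0 = A \<union> B" by (simp only: \<Sigma>0_def Range_Un_eq ran12 ran3)
  have hz_not: "h z \<notin> Domain E2" if "z \<in> \<Omega>" for z
    unfolding dom2 using pS that by (meson disjoint_iff imageI)
  have ind: "(z, u) \<in> induced \<Sigma>0 \<longleftrightarrow> z \<in> \<Omega> \<and> ((h z, u) \<in> E1 \<or> (h z, u) \<in> E3)" for z u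
    using hz_not[of z] by (auto simp: induced_def \<Sigma>0_def)
  have indA: "z \<in> A \<and> u \<in> A \<or> z \<notin> A \<and> u \<in> B \<and> h z \<in> Domain E3" if zu: "(z, u) \<in> induced \<Sigma>0" for z u
  proof -
    have z: "z \<in> \<Omega>" using zu ind by blast
    from zu ind consider "(h z, u) \<in> E1" | "(h z, u) \<in> E3" by blast
    then show ?thesis
    proof cases
      case 1
      then obtain x where "x \<in> \<Omega> - C" "h z = h (\<alpha> x)" "u = \<alpha> (f x)" by (auto simp: E1_def)
      then show ?thesis using inj_onD[OF inj(3), of z "\<alpha> x"] z \<alpha>A fC by auto
    next
      case 2
      then have "h z \<in> Domain E3" "u \<in> B" using ran3 by auto
      moreover have "h z \<in> S" using \<open>h z \<in> Domain E3\<close> dom3 by auto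
      ultimately show ?thesis using hAS by blast
    qed
  qed
  have SB: "w \<in> B \<longleftrightarrow> u \<in> B" if "(w, u) \<in> \<Sigma>0" for w u
  proof -
    from that consider "(w, u) \<in> E1 \<union> E2" | "(w, u) \<in> E3" by (auto simp: \<Sigma>0_def)
    then show ?thesis
    proof cases
      case 1
      then have "u \<in> A" using ran12 by auto
      moreover have "w \<in> W" "w \<notin> Domain E3"
      proof -
        have "w \<in> Domain (E1 \<union> E2)" using 1 by auto
        then show "w \<notin> Domain E3" using disj3 by blast
        show "w \<in> W" using 1 \<alpha>A h_W p_W by (auto simp: E1_def E2_def)
      qed
      ultimately show ?thesis using AB B_W by blast
    next
      case 2
      then show ?thesis using ran3 B_W by blast
    qed
  qed
  \<comment> \<open>Outside \<open>A\<close>, the edges of the first factor lead from \<open>h\<close>-preimages of points of \<open>B\<close> into \<open>B\<close>, and by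
     sparseness no point of \<open>B\<close> is such a preimage.\<close>
  have isoA: "x \<notin> Domain (induced \<Sigma>0) \<inter> Range (induced \<Sigma>0)" if x: "x \<in> \<Omega> - A" for x
  proof
    assume a: "x \<in> Domain (induced \<Sigma>0) \<inter> Range (induced \<Sigma>0)"
    then have "x \<in> B" using indA x by blast
    moreover have "h x \<in> S2" "h x \<in> S" using a indA x dom3 by blast+
    then have hh: "h x \<in> h ` h ` \<Omega>" using S by auto
    have "x \<in> h ` \<Omega>"
    proof -
      obtain v where "v \<in> \<Omega>" "h x = h (h v)" using hh by auto
      then have "x = h v" using inj_onD[OF inj(3), of x "h v"] x h\<Omega> by auto
      then show ?thesis using \<open>v \<in> \<Omega>\<close> by auto
    qed
    ultimately have "x \<in> S" using B_cases by blast
    then show False using S_sparse(1) \<open>h x \<in> S\<close> by blast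
  qed
  \<comment> \<open>Outside \<open>B\<close>, the edges of the second factor lead out of \<open>A\<close>, and none of them ends in \<open>A\<close>.\<close>
  have isoB: "x \<notin> Domain \<Sigma>0 \<inter> Range \<Sigma>0" if x: "x \<in> \<Omega> - B" for x
  proof
    assume a: "x \<in> Domain \<Sigma>0 \<inter> Range \<Sigma>0"
    then have "x \<in> A" using Ran x by auto
    then have "x \<in> S" "x \<in> h ` \<Omega>" using AS S_h by auto
    then have "x \<in> Domain E3" using a Dom hAS pS by blast
    then show False using x B_W by auto
  qed
  \<comment> \<open>The third part of the sparse set is kept free as the supply of fresh points.\<close>
  have S3_fresh: "u \<in> fresh \<Sigma>0" if u: "u \<in> S3" for u
  proof -
    have uS: "u \<in> S" "u \<notin> S1" "u \<notin> S2" using u S3 S' S2 by auto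
    have u\<Omega>: "u \<in> \<Omega>" "h u \<in> \<Omega>" "h (h u) \<in> \<Omega>" using uS S_h h\<Omega> by auto
    have huS: "h u \<notin> S" using S_sparse(1) uS by blast
    have notB: "x \<notin> B" if "x \<in> h ` \<Omega>" "x \<notin> S2" for x using that B_cases by blast
    have 1: "u \<notin> A" "h u \<notin> A" using uS AS huS by auto
    have 2: "u \<notin> B" "h u \<notin> B" using notB[of u] notB[of "h u"] uS u\<Omega> S_h huS S2 S' by auto
    have hA: "h v \<notin> h ` A" if "v \<in> \<Omega>" "v \<notin> A" for v
      using inj_onD[OF inj(3), of v] that A\<Omega> by auto
    have 3: "u \<notin> h ` A" "h u \<notin> h ` A" "h (h u) \<notin> h ` A"
      using hAS uS hA[of u] hA[of "h u"] u\<Omega> 1 by auto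
    have 4: "u \<notin> Domain E3" "h u \<notin> Domain E3" using dom3 uS huS by auto
    have 5: "h (h u) \<notin> Domain E3"
    proof
      assume "h (h u) \<in> Domain E3"
      then have "h (h u) \<in> S2" "h (h u) \<in> S" using dom3 by auto
      then show False using S_sparse(2)[of u "h (h u)"] uS by metis
    qed
    have 6: "u \<notin> p ` (\<Omega> - f ` \<Omega> - C)" "h u \<notin> p ` (\<Omega> - f ` \<Omega> - C)" "h (h u) \<notin> p ` (\<Omega> - f ` \<Omega> - C)"
      using pS u\<Omega> uS S_h by blast+
    have "h u \<noteq> u" using S_sparse(1) uS by blast
    then show ?thesis using 1 2 3 4 5 6 u\<Omega> unfolding fresh_def Dom Ran by blast
  qed
  have adm: "admissible \<Sigma>0"
    unfolding admissible_def
  proof (intro conjI)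
    show "\<Sigma>0 \<subseteq> W \<times> \<Omega>"
    proof -
      have "Domain \<Sigma>0 \<subseteq> W" unfolding Dom using A\<Omega> h_W p_W B_W by blast
      moreover have "Range \<Sigma>0 \<subseteq> \<Omega>" unfolding Ran using A\<Omega> B\<Omega> by blast
      ultimately show ?thesis by auto
    qed
    show "single_valued \<Sigma>0" "single_valued (\<Sigma>0\<inverse>)" by fact+
    show "A \<subseteq> Range \<Sigma>0" "h ` A \<subseteq> Domain \<Sigma>0" "B \<subseteq> Range \<Sigma>0" "B \<inter> W \<subseteq> Domain \<Sigma>0"
      unfolding Dom Ran B_W by blast+
    show "\<forall>(z, u)\<in>induced \<Sigma>0. z \<in> A \<longleftrightarrow> u \<in> A" using indA AB by blast
    show "\<forall>(w, u)\<in>\<Sigma>0. w \<in> B \<longleftrightarrow> u \<in> B" using SB by blast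
    have inX: "x \<in> \<Omega> - A \<longleftrightarrow> y \<in> \<Omega> - A" if "(x, y) \<in> induced \<Sigma>0" for x y
      using indA[OF that] ind that AB A\<Omega> B\<Omega> by blast
    show "terminates_on (\<Omega> - A) (induced \<Sigma>0)"
      using isoA inX by (rule terminates_on_isolated_edges)
    show "terminates_on (\<Omega> - A) ((induced \<Sigma>0)\<inverse>)"
      by (rule terminates_on_isolated_edges) (use isoA inX in auto)
    have inX: "x \<in> \<Omega> - B \<longleftrightarrow> y \<in> \<Omega> - B" if "(x, y) \<in> \<Sigma>0" for x y
      using SB[OF that] that \<open>\<Sigma>0 \<subseteq> W \<times> \<Omega>\<close> W by blast
    show "terminates_on (\<Omega> - B) \<Sigma>0"
      using isoB inX by (rule terminates_on_isolated_edges)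
    show "terminates_on (\<Omega> - B) (\<Sigma>0\<inverse>)"
      by (rule terminates_on_isolated_edges) (use isoB inX in auto)
    show "infinite (fresh \<Sigma>0)" using S3(2) S3_fresh infinite_super[of S3 "fresh \<Sigma>0"] by blast
    have *: "\<exists>m\<in>C - f ` C. w = p m" if w: "w \<in> W - h ` \<Omega> - \<Sigma>0\<inverse> `` A" for w
    proof -
      obtain m where m: "m \<in> \<Omega> - f ` \<Omega>" "w = p m" using W_p w by blast
      have "m \<in> C"
      proof (rule ccontr)
        assume "m \<notin> C"
        then have "(p m, \<alpha> m) \<in> \<Sigma>0" "\<alpha> m \<in> A" using m \<alpha>A by (auto simp: \<Sigma>0_def E2_def)
        then show False using m w by blast
      qed
      then show ?thesis using m start_f by blast
    qed
    show "\<forall>w \<in> W - h ` \<Omega> - \<Sigma>0\<inverse> `` A. \<forall>w' \<in> W - h ` \<Omega> - \<Sigma>0\<inverse> `` A. w = w'"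
      using infinite_orbit_start_unique[OF orb_f] by (intro ballI) (metis *)
  qed

  obtain \<sigma> where \<sigma>: "bij_betw \<sigma> W \<Omega>" "\<And>w u. (w, u) \<in> \<Sigma>0 \<Longrightarrow> \<sigma> w = u"
    and orb_A: "infinite_orbit (\<Omega> - A) (\<lambda>z. \<sigma> (h z))"
    and orb_B: "infinite_orbit (\<Omega> - B) (inv_into W \<sigma>)"
    using complete_linking[OF adm] by blast
  have \<sigma>W: "\<sigma> w \<in> \<Omega>" if "w \<in> W" for w using \<sigma>(1) that by (auto simp: bij_betw_def)
  have \<sigma>_inj: "w = w'" if "\<sigma> w = \<sigma> w'" "w \<in> W" "w' \<in> W" for w w'
    using \<sigma>(1) that by (auto simp: bij_betw_def inj_on_def)
  have \<sigma>_surj: "\<exists>w\<in>W. \<sigma> w = z" if "z \<in> \<Omega>" for z using \<sigma>(1) that by (metis bij_betw_def imageE)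
  have \<sigma>\<alpha>: "\<sigma> (h (\<alpha> x)) = \<alpha> (f x)" if "x \<in> \<Omega> - C" for x
    using that by (intro \<sigma>(2)) (auto simp: \<Sigma>0_def E1_def)
  have \<sigma>p: "\<sigma> (p m) = \<alpha> m" if "m \<in> \<Omega> - f ` \<Omega> - C" for m
    using that by (intro \<sigma>(2)) (auto simp: \<Sigma>0_def E2_def)
  have \<sigma>\<beta>: "\<sigma> (\<beta> (g y)) = \<beta> y" if "y \<in> \<Omega> - D" for y
    using that by (intro \<sigma>(2)) (auto simp: \<Sigma>0_def E3_def)
  have inv\<sigma>: "inv_into W \<sigma> (\<sigma> w) = w" if "w \<in> W" for w
    using \<sigma>(1) that by (simp add: bij_betw_def inv_into_f_f)
  have inv\<beta>: "inv_into W \<sigma> (\<beta> y) = \<beta> (g y)" if "y \<in> \<Omega> - D" for y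
    using inv\<sigma>[of "\<beta> (g y)"] \<sigma>\<beta>[OF that] S_W \<beta>g[OF that] by auto

  \<comment> \<open>The infinite orbit of \<open>\<sigma> \<circ> h\<close> has a first point, namely \<open>\<sigma> (p m)\<close>, exactly if \<open>C\<close> has a first point \<open>m\<close>.\<close>
  have eqA: "f ` C = C \<longleftrightarrow> (\<lambda>z. \<sigma> (h z)) ` (\<Omega> - A) = \<Omega> - A"
  proof
    assume surj: "f ` C = C"
    show "(\<lambda>z. \<sigma> (h z)) ` (\<Omega> - A) = \<Omega> - A"
    proof (intro equalityI subsetI)
      fix z assume z: "z \<in> \<Omega> - A"
      obtain w where w: "w \<in> W" "\<sigma> w = z" using \<sigma>_surj z by blast
      have "w \<in> h ` \<Omega>"
      proof (rule ccontr)
        assume "w \<notin> h ` \<Omega>"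
        then obtain m where m: "m \<in> \<Omega> - f ` \<Omega>" "w = p m" using W_p w by blast
        show False
        proof (cases "m \<in> C")
          case True
          then show False using start_f[OF m(1)] surj by auto
        next
          case False
          then show False using \<sigma>p[of m] m w z \<alpha>A[of m] by auto
        qed
      qed
      then obtain v where v: "v \<in> \<Omega>" "w = h v" by auto
      have "v \<notin> A"
      proof
        assume "v \<in> A"
        then obtain x where "x \<in> \<Omega> - C" "v = \<alpha> x" by (auto simp: A_def)
        then show False using \<sigma>\<alpha>[of x] w v z \<alpha>A(1)[OF fC[of x]] by auto
      qed
      then show "z \<in> (\<lambda>z. \<sigma> (h z)) ` (\<Omega> - A)" using v w by blast
    qed (use infinite_orbitD(1)[OF orb_A] in auto)
  next
    assume surj: "(\<lambda>z. \<sigma> (h z)) ` (\<Omega> - A) = \<Omega> - A"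
    show "f ` C = C"
    proof (rule ccontr)
      assume "f ` C \<noteq> C"
      then obtain m where m: "m \<in> C" "m \<notin> f ` C" using infinite_orbitD(1)[OF orb_f] by auto
      then have m\<Omega>: "m \<in> \<Omega> - f ` \<Omega>" using C\<Omega> C_inv by auto
      have notA: "\<sigma> (p m) \<notin> A"
      proof
        assume "\<sigma> (p m) \<in> A"
        then obtain x where x: "x \<in> \<Omega> - C" "\<sigma> (p m) = \<alpha> x" by (auto simp: A_def)
        show False
        proof (cases "x \<in> f ` \<Omega>")
          case True
          then obtain v where v: "v \<in> \<Omega>" "x = f v" by auto
          then have "v \<in> \<Omega> - C" using x C_inv by auto
          then have "\<sigma> (p m) = \<sigma> (h (\<alpha> v))" using \<sigma>\<alpha> x v by auto
          then have "p m = h (\<alpha> v)" using \<sigma>_inj p_W[OF m\<Omega>] h_W \<alpha>A[OF \<open>v \<in> \<Omega> - C\<close>] by auto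
          then show False using p_W[OF m\<Omega>] \<alpha>A[OF \<open>v \<in> \<Omega> - C\<close>] by auto
        next
          case False
          then have "\<sigma> (p m) = \<sigma> (p x)" using \<sigma>p x by auto
          then have "p m = p x" using \<sigma>_inj p_W[OF m\<Omega>] p_W[of x] x False by auto
          then have "m = x" using inj_onD[OF p] m\<Omega> x False by auto
          then show False using m x by auto
        qed
      qed
      then have "\<sigma> (p m) \<in> (\<lambda>z. \<sigma> (h z)) ` (\<Omega> - A)" unfolding surj using \<sigma>W p_W[OF m\<Omega>] by auto
      then obtain z where z: "z \<in> \<Omega>" "\<sigma> (p m) = \<sigma> (h z)" by auto
      then have "p m = h z" using \<sigma>_inj p_W[OF m\<Omega>] h_W by auto
      then show False using p_W[OF m\<Omega>] z by auto
    qed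
  qed
  \<comment> \<open>Likewise for \<open>\<sigma>\<^sup>-\<^sup>1\<close> and \<open>D\<close>, with first point \<open>q m\<close>.\<close>
  have eqB: "g ` D = D \<longleftrightarrow> inv_into W \<sigma> ` (\<Omega> - B) = \<Omega> - B"
  proof
    assume surj: "g ` D = D"
    show "inv_into W \<sigma> ` (\<Omega> - B) = \<Omega> - B"
    proof (intro equalityI subsetI)
      fix z assume z: "z \<in> \<Omega> - B"
      have "z \<in> W"
      proof (rule ccontr)
        assume "z \<notin> W"
        then obtain m where m: "m \<in> \<Omega> - g ` \<Omega>" "z = q m" using z by (auto simp: W_def)
        show False
        proof (cases "m \<in> D")
          case True
          then show False using start_g[OF m(1)] surj by auto
        next
          case False
          then have "\<beta> m \<in> B" using m by (auto simp: B_def)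
          then show False using m z by (simp add: \<beta>_def)
        qed
      qed
      have "\<sigma> z \<notin> B"
      proof
        assume "\<sigma> z \<in> B"
        then obtain y where y: "y \<in> \<Omega> - D" "\<sigma> z = \<beta> y" by (auto simp: B_def)
        then have "z = \<beta> (g y)" using inv\<beta>[OF y(1)] inv\<sigma>[OF \<open>z \<in> W\<close>] by simp
        then show False using z gD[OF y(1)] by (auto simp: B_def)
      qed
      then show "z \<in> inv_into W \<sigma> ` (\<Omega> - B)"
        using inv\<sigma>[OF \<open>z \<in> W\<close>] \<sigma>W[OF \<open>z \<in> W\<close>] by (metis DiffI image_eqI)
    qed (use infinite_orbitD(1)[OF orb_B] in auto)
  next
    assume surj: "inv_into W \<sigma> ` (\<Omega> - B) = \<Omega> - B"
    show "g ` D = D"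
    proof (rule ccontr)
      assume "g ` D \<noteq> D"
      then obtain m where m: "m \<in> D" "m \<notin> g ` D" using infinite_orbitD(1)[OF orb_g] by auto
      then have m\<Omega>: "m \<in> \<Omega> - g ` \<Omega>" using D\<Omega> D_inv by auto
      have qm: "q m \<in> \<Omega>" "q m \<notin> h ` \<Omega>" "q m \<notin> W" using m\<Omega> pq_im by (auto simp: W_def)
      have "q m \<notin> B"
      proof
        assume "q m \<in> B"
        then obtain y where y: "y \<in> \<Omega> - D" "q m = \<beta> y" by (auto simp: B_def)
        have "\<gamma> y \<in> h ` \<Omega>" using \<gamma>(2) y S2 S' S_h by blast
        then have "y \<notin> g ` \<Omega>" using y(2) qm by (auto simp: \<beta>_def)
        then have "m = y" using inj_onD[OF q, of m y] y m\<Omega> by (auto simp: \<beta>_def)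
        then show False using m y by auto
      qed
      then have "q m \<in> inv_into W \<sigma> ` (\<Omega> - B)" unfolding surj using qm by auto
      then obtain z where "z \<in> \<Omega>" "q m = inv_into W \<sigma> z" by auto
      then have "q m \<in> W" using \<sigma>(1) by (metis bij_betw_def inv_into_into)
      then show False using qm by auto
    qed
  qed
  obtain \<theta> where \<theta>: "\<theta> permutes \<Omega>" "\<And>x. x \<in> \<Omega> \<Longrightarrow> \<theta> (f x) = \<sigma> (h (\<theta> x))"
  proof -
    have "bij_betw \<alpha> (\<Omega> - C) A" using \<alpha>(1) by (simp add: A_def bij_betw_def)
    then show ?thesis
      using that glue_conjugation[OF C\<Omega> A\<Omega> _ _ _ orb_f orb_A eqA, of \<alpha>] f\<Omega> C_inv \<sigma>\<alpha> by metis
  qed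
  obtain \<eta> where \<eta>: "\<eta> permutes \<Omega>" "\<And>x. x \<in> \<Omega> \<Longrightarrow> \<eta> (g x) = inv_into W \<sigma> (\<eta> x)"
  proof -
    have "bij_betw \<beta> (\<Omega> - D) B" using \<beta> by (simp add: B_def bij_betw_def)
    then show ?thesis
      using that glue_conjugation[OF D\<Omega> B\<Omega> _ _ _ orb_g orb_B eqB, of \<beta>] g\<Omega> D_inv inv\<beta> by metis
  qed
  have "h z = \<eta> (g (inv \<eta> (\<theta> (f (inv \<theta> z)))))" if z: "z \<in> \<Omega>" for z
  proof -
    have "inv \<theta> z \<in> \<Omega>" using z permutes_in_image[OF permutes_inv[OF \<theta>(1)]] by simp
    then have 1: "\<theta> (f (inv \<theta> z)) = \<sigma> (h z)"
      using \<theta> permutes_inverses(1)[OF \<theta>(1)] by simp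
    have "\<sigma> (h z) \<in> \<Omega>" using \<sigma>W h_W z by simp
    then have "inv \<eta> (\<sigma> (h z)) \<in> \<Omega>" using permutes_in_image[OF permutes_inv[OF \<eta>(1)]] by simp
    then have "\<eta> (g (inv \<eta> (\<sigma> (h z)))) = inv_into W \<sigma> (\<sigma> (h z))"
      using \<eta> permutes_inverses(1)[OF \<eta>(1)] by simp
    then show ?thesis using 1 inv\<sigma>[OF h_W[OF z]] by simp
  qed
  then show ?thesis using \<theta>(1) \<eta>(1) by blast
qed

theorem corollary12:
  fixes \<Omega> :: "'a set" and f g h :: "'a \<Rightarrow> 'a"
  assumes "countable \<Omega>" and "infinite \<Omega>"
    and "f \<in> Inj \<Omega>" and "g \<in> Inj \<Omega>" and "h \<in> Inj \<Omega>"
    and "infinite (support \<Omega> f)" and "infinite (support \<Omega> g)" and "infinite (support \<Omega> h)"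
    and "has_infinite_cycle \<Omega> f" and "has_infinite_cycle \<Omega> g"
  shows "(\<exists>a\<in>Sym \<Omega>. \<exists>b\<in>Sym \<Omega>. \<forall>\<alpha>\<in>\<Omega>. h \<alpha> = conj_product a f b g \<alpha>) \<longleftrightarrow>
         |\<Omega> - f ` \<Omega>| +c |\<Omega> - g ` \<Omega>| =o |\<Omega> - h ` \<Omega>|"
proof
  assume "\<exists>a\<in>Sym \<Omega>. \<exists>b\<in>Sym \<Omega>. \<forall>\<alpha>\<in>\<Omega>. h \<alpha> = conj_product a f b g \<alpha>"
  then obtain a b where "a permutes \<Omega>" "b permutes \<Omega>"
    and "\<And>z. z \<in> \<Omega> \<Longrightarrow> h z = conj_product a f b g z"
    by (auto simp: Sym_def)
  then show "|\<Omega> - f ` \<Omega>| +c |\<Omega> - g ` \<Omega>| =o |\<Omega> - h ` \<Omega>|"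
    by (rule conj_product_deficiency[OF assms(3,4)])
next
  assume "|\<Omega> - f ` \<Omega>| +c |\<Omega> - g ` \<Omega>| =o |\<Omega> - h ` \<Omega>|"
  then obtain k where k: "bij_betw k ((\<Omega> - f ` \<Omega>) <+> (\<Omega> - g ` \<Omega>)) (\<Omega> - h ` \<Omega>)"
    unfolding csum_def Field_card_of card_of_ordIso[symmetric] by (rule exE)
  obtain C D where "cycle_under \<Omega> f C" "infinite C" "cycle_under \<Omega> g D" "infinite D"
    using assms(9,10) by (auto simp: has_infinite_cycle_def)
  then obtain \<theta> \<eta> where perm: "\<theta> permutes \<Omega>" "\<eta> permutes \<Omega>"
    and h: "\<And>z. z \<in> \<Omega> \<Longrightarrow> h z = \<eta> (g (inv \<eta> (\<theta> (f (inv \<theta> z)))))"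
    using factorization_exists[OF assms(1,3,4,5,8) _ _ _ _ k] by metis
  have "inv \<theta> \<in> Sym \<Omega>" "inv \<eta> \<in> Sym \<Omega>" using perm permutes_inv by (auto simp: Sym_def)
  moreover have "\<forall>z\<in>\<Omega>. h z = conj_product (inv \<theta>) f (inv \<eta>) g z"
    using h perm by (simp add: conj_product_def permutes_inv_inv)
  ultimately show "\<exists>a\<in>Sym \<Omega>. \<exists>b\<in>Sym \<Omega>. \<forall>\<alpha>\<in>\<Omega>. h \<alpha> = conj_product a f b g \<alpha>"
    by blast
qed

end
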